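(* Let $s,t\ge 1$ be coprime integers. Then $$\frac{\sum_{\lambda\in \mathcal{D}_s\cap \mathcal{D}_t} |\mathrm{Stab}_{H_{s,t}}(\lambda)|^{-1}\cdot |\lambda|}{\sum_{\lambda\in \mathcal{D}_s\cap \mathcal{D}_t} |\mathrm{Stab}_{H_{s,t}}(\lambda)|^{-1}} = \begin{cases}\frac{1}{24}(s-1)(t^2-1) & \text{if } t\equiv1\pmod 2,\\ \frac{1}{24}(s-1)(t^2+2) & \text{if } t\equiv0\pmod 2,\end{cases}$$ where the (finite) sums run over all self-conjugate partitions that are simultaneously $s$-cores and $t$-cores, and the (finite) stabilizers are taken with respect to the action of the group $H_{s,t}$ on $\mathcal{D}_s$.
   Context: A partition is an infinite weakly decreasing sequence $\lambda=(\lambda_1,\lambda_2,\ldots)$ of nonnegative integers with finite size $|\lambda|=\lambda_1+\lambda_2+\cdots$. Its Young diagram is $[\lambda]=\{(r,c)\in\mathbb{Z}_{>0}^2 : c\le\lambda_r\}$, its conjugate $\overline{\lambda}$ is given by $\overline{\lambda}_r=\#\{c\in\mathbb{Z}_{>0}: r\le\lambda_c\}$ ($\lambda$ is self-conjugate if $\lambda=\overline\lambda$), and the hook length at $(r,c)\in[\lambda]$ is $1+(\lambda_r-r)+(\overline{\lambda}_c-c)$. A partition is an $s$-core if it has no hook of length $s$; $\mathcal{C}_s$ is the set of $s$-cores and $\mathcal{D}_s\subseteq\mathcal{C}_s$ the set of self-conjugate $s$-cores. For coprime $s,t$, the set $\mathcal{C}_s\cap\mathcal{C}_t$ is finite. Beta-sets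 and $s$-sets: the beta-set of $\lambda$ is $B^\lambda=\{\lambda_i-i : i\ge1\}\subset\mathbb{Z}$; $\lambda$ is an $s$-core iff $B^\lambda-s\subseteq B^\lambda$. For an $s$-core $\lambda$, its $s$-set is $\mathcal{S}_s(\lambda)=(B^\lambda+s)\setminus B^\lambda$; $\lambda\mapsto\mathcal{S}_s(\lambda)$ is a bijection from $\mathcal{C}_s$ to the collection of all sets of $s$ integers that are pairwise incongruent modulo $s$ and have sum $\binom{s}{2}$. An $s$-core $\lambda$ is self-conjugate iff $\mathcal{S}_s(\lambda)=s-1-\mathcal{S}_s(\lambda)$. The group $H_{s,t}$: the group (under composition) of permutations $f:\mathbb{Z}\to\mathbb{Z}$ such that $f(m+s)=f(m)+s$ for all $m$; $\sum_{i=0}^{s-1}f(i)=\binom{s}{2}$; $f(m)\equiv m\pmod t$ for all $m$; and $f(-1-m)=-1-f(m)$ for all $m$. It acts on $\mathcal{D}_s$ by letting $f\lambda$ be the self-conjugate $s$-core with $\mathcal{S}_s(f\lambda)=f(\mathcal{S}_s(\lambda))$ (equivalently $B^{f\lambda}=f(B^\lambda)$). *)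

theory Defs
  imports Complex_Main "HOL-Algebra.Group_Action" "HOL-Number_Theory.Cong"
begin

(* A partition (l_1, l_2, ...) is a function on nat indexed from 1; index 0 carries no
   information, and fixing its value to 0 makes equality of functions equality of partitions.
   For an integer sequence, finite size and finite support are the same condition. *)
definition is_partition :: "(nat \<Rightarrow> nat) \<Rightarrow> bool" where
  "is_partition l \<longleftrightarrow> l 0 = 0 \<and> antimono_on {1..} l \<and> finite {i. l i \<noteq> 0}"

definition psize :: "(nat \<Rightarrow> nat) \<Rightarrow> nat" where
  "psize l = (\<Sum>i | l i \<noteq> 0. l i)"

definition young_diagram :: "(nat \<Rightarrow> nat) \<Rightarrow> (nat \<times> nat) set" where
  "young_diagram l = {(r, c). 1 \<le> r \<and> 1 \<le> c \<and> c \<le> l r}"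

(* The case r = 0 keeps the convention that index 0 is unused. *)
definition conj_partition :: "(nat \<Rightarrow> nat) \<Rightarrow> nat \<Rightarrow> nat" where
  "conj_partition l r = (if r = 0 then 0 else card {c. 1 \<le> c \<and> r \<le> l c})"

definition hook_length :: "(nat \<Rightarrow> nat) \<Rightarrow> nat \<Rightarrow> nat \<Rightarrow> int" where
  "hook_length l r c = 1 + (int (l r) - int r) + (int (conj_partition l c) - int c)"

definition cores :: "nat \<Rightarrow> (nat \<Rightarrow> nat) set" where
  "cores s = {l. is_partition l \<and> (\<forall>(r, c) \<in> young_diagram l. hook_length l r c \<noteq> int s)}"

definition self_conj_cores :: "nat \<Rightarrow> (nat \<Rightarrow> nat) set" where
  "self_conj_cores s = {l \<in> cores s. conj_partition l = l}"

definition beta_set :: "(nat \<Rightarrow> nat) \<Rightarrow> int set" where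
  "beta_set l = {int (l i) - int i | i. 1 \<le> i}"

definition s_set :: "nat \<Rightarrow> (nat \<Rightarrow> nat) \<Rightarrow> int set" where
  "s_set s l = (\<lambda>b. b + int s) ` beta_set l - beta_set l"

definition H_group :: "nat \<Rightarrow> nat \<Rightarrow> (int \<Rightarrow> int) monoid" where
  "H_group s t =
     \<lparr>carrier = {f. bij f \<and>
        (\<forall>m. f (m + int s) = f m + int s) \<and>
        (\<Sum>i = 0..<int s. f i) = int (s choose 2) \<and>
        (\<forall>m. [f m = m] (mod int t)) \<and>
        (\<forall>m. f (- 1 - m) = - 1 - f m)},
      monoid.mult = (\<circ>),
      one = id\<rparr>"

(* For l in self_conj_cores s and f in the carrier of H_group s t, existence and uniqueness of
   the described partition follow from the bijection between s-cores and sets of s integers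
   that are pairwise incongruent mod s and have sum (s choose 2), under which the self-conjugate
   cores correspond to the sets fixed by x |-> s - 1 - x. *)
definition core_action :: "nat \<Rightarrow> (int \<Rightarrow> int) \<Rightarrow> (nat \<Rightarrow> nat) \<Rightarrow> (nat \<Rightarrow> nat)" where
  "core_action s f l = (THE m. m \<in> self_conj_cores s \<and> s_set s m = f ` s_set s l)"

end

theory Submission
  imports Defs
begin

text \<open>Encode a self-conjugate s-core by its beta-set. Every one of these is the image of the negative
  integers under an element f of the affine hyperoctahedral group of the permutations commuting with
  \<open>m \<mapsto> m + s\<close> and \<open>m \<mapsto> - 1 - m\<close>, and f is unique up to a finite subgroup. Such an f is determined
  modulo the left action of \<open>H\<^bsub>s,t\<^esub>\<close> by its residues modulo t on the first half of the window
  \<open>0, \<dots>, s - 1\<close>, and these residues can be prescribed arbitrarily. Each \<open>H\<^bsub>s,t\<^esub>\<close>-orbit contains exactly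
  one t-core, so the weights \<open>1 / |Stab|\<close> turn the quotient of the two sums into the average of the
  size of this core over uniformly random, independent residues. The size is a sum of squares of
  the elements of the t-set, shifted to be symmetric about 0; each shifted element is an affine
  function of the number of residues that lie in an arc of the cycle \<open>r, r - s, r - 2 s, \<dots>\<close> of residue
  classes, so its second moment is that of a sum of independent variables.\<close>

section \<open>Partitions and beta-sets\<close>

text \<open>The two cases in the parity of \<open>t\<close> arise as follows. Walking along the
  cycle from \<open>r\<close> to the class of \<open>- 1 - r\<close> and comparing with the
  reflected gap there solves for the gap at \<open>r\<close>: up to constants it is \<open>t\<close>
  times the number of residues met on an arc of \<open>k\<close> classes. A residue from the first
  half of the window counts twice, because its mirror image is met as well, and contributes a
  variance proportional to \<open>k * (t - k)\<close>. For odd \<open>s\<close> the middle position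
  \<open>(s - 1) / 2\<close> is fixed by every group element and adds a deterministic bias. For odd
  \<open>t\<close> the arc lengths run once through \<open>0, ..., t - 1\<close>. For even
  \<open>t\<close> they do not, since 2 is not invertible modulo \<open>t\<close>; but then
  \<open>s\<close> is odd, and the biases run through \<open>t - 1, t - 3, ..., 1 - t\<close>. The
  sum of their absolute values depends on the parity of \<open>t\<close>, and this separates
  \<open>t^2 - 1\<close> from \<open>t^2 + 2\<close>. Even \<open>t\<close> is also the obstacle to
  existence: a symmetric abacus with prescribed class counts then needs the count of the middle
  class to be odd, which the fixed middle position guarantees.\<close>

lemma finite_down_closed_eq_interval:
  fixes A :: "nat set"
  assumes "finite A" "\<And>i. i \<in> A \<Longrightarrow> 1 \<le> i" "\<And>i j. i \<in> A \<Longrightarrow> 1 \<le> j \<Longrightarrow> j \<le> i \<Longrightarrow> j \<in> A"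
  shows "A = {1..card A}"
proof (cases "A = {}")
  case False
  have "A = {1..Max A}"
  proof
    show "A \<subseteq> {1..Max A}" using assms(1,2) by auto
    show "{1..Max A} \<subseteq> A" using assms(3)[OF Max_in[OF assms(1) False]] by auto
  qed
  then show ?thesis
    by (metis card_atLeastAtMost diff_Suc_1)
qed simp

lemma partition_antimono:
  assumes "is_partition l" "1 \<le> i" "i \<le> j" shows "l j \<le> l i"
  using assms unfolding is_partition_def monotone_on_def by auto

text \<open>Parts decrease, so the rows that reach column \<open>c\<close> form an initial segment,
  and their number is the index of the last of them. Rows and columns are thereby related by a
  Galois connection.\<close>

lemma le_conj_partition_iff:
  assumes "is_partition l" "1 \<le> i" "1 \<le> c"
  shows "i \<le> conj_partition l c \<longleftrightarrow> c \<le> l i"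
proof -
  let ?A = "{i. 1 \<le> i \<and> c \<le> l i}"
  have "finite {i. l i \<noteq> 0}" using assms(1) by (simp add: is_partition_def)
  then have "finite ?A"
    by (rule rev_finite_subset) (use assms(3) in auto)
  then have "?A = {1..card ?A}"
    by (rule finite_down_closed_eq_interval) (auto intro: order_trans[OF _ partition_antimono[OF assms(1)]])
  then have "i \<in> ?A \<longleftrightarrow> i \<in> {1..card ?A}" by (rule arg_cong)
  then show ?thesis
    using assms(2,3) unfolding conj_partition_def by simp
qed

lemma is_partition_conj_partition:
  assumes "is_partition l" shows "is_partition (conj_partition l)"
  unfolding is_partition_def
proof (intro conjI)
  show "conj_partition l 0 = 0" by (simp add: conj_partition_def)
  show "antimono_on {1..} (conj_partition l)"
  proof (rule monotone_onI)
    fix c d :: nat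
    assume "c \<in> {1..}" "d \<in> {1..}" "c \<le> d"
    then show "conj_partition l c \<ge> conj_partition l d"
      using le_conj_partition_iff[OF assms, of "conj_partition l d" c]
        le_conj_partition_iff[OF assms, of "conj_partition l d" d]
      by (cases "conj_partition l d = 0") auto
  qed
  have "conj_partition l c = 0" if "l 1 < c" for c
    using le_conj_partition_iff[OF assms, of 1 c] that by auto
  then have "{c. conj_partition l c \<noteq> 0} \<subseteq> {..l 1}"
    by (auto intro: leI)
  then show "finite {c. conj_partition l c \<noteq> 0}"
    using finite_subset by blast
qed

lemma beta_strict_antimono:
  assumes "is_partition l" "1 \<le> i" "i < j" shows "int (l j) - int j < int (l i) - int i"
  using partition_antimono[OF assms(1,2), of j] assms(3) by linarith

lemma beta_less_iff:
  assumes "is_partition l" "1 \<le> i" "1 \<le> j"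
  shows "int (l j) - int j < int (l i) - int i \<longleftrightarrow> i < j"
  using beta_strict_antimono[OF assms(1)] assms(2,3) by (metis linorder_less_linear order_less_asym)

lemma partition_eventually_0:
  assumes "is_partition l" obtains N where "\<And>i. i > N \<Longrightarrow> l i = 0"
proof -
  have "finite {i. l i \<noteq> 0}" using assms by (simp add: is_partition_def)
  then obtain N where "\<forall>i\<in>{i. l i \<noteq> 0}. i \<le> N" using finite_nat_set_iff_bounded_le by blast
  then show ?thesis using that by (metis mem_Collect_eq not_le)
qed

text \<open>The vertical steps of the boundary of the Young diagram carry the labels in the beta-set, the
  horizontal ones those in its complement.\<close>

lemma beta_gt_cobeta_iff:
  assumes "is_partition l" "1 \<le> i" "1 \<le> c"
  shows "int c - 1 - int (conj_partition l c) < int (l i) - int i \<longleftrightarrow> c \<le> l i"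
    and "int c - 1 - int (conj_partition l c) \<noteq> int (l i) - int i"
  using le_conj_partition_iff[OF assms] by (cases "c \<le> l i"; linarith)+

lemma not_in_beta_set_iff:
  assumes "is_partition l"
  shows "y \<notin> beta_set l \<longleftrightarrow> (\<exists>c\<ge>1. y = int c - 1 - int (conj_partition l c))"
proof
  assume y: "y \<notin> beta_set l"
  let ?A = "{i. 1 \<le> i \<and> y < int (l i) - int i}"
  obtain N where N: "\<And>i. i > N \<Longrightarrow> l i = 0" using partition_eventually_0[OF assms] by blast
  have "i \<le> N + nat \<bar>y\<bar>" if "i \<in> ?A" for i
    using N[of i] that by (cases "i > N") auto
  then have "?A \<subseteq> {..N + nat \<bar>y\<bar>}" by auto
  then have fin: "finite ?A" using finite_subset by blast
  have A: "?A = {1..card ?A}"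
    using fin by (rule finite_down_closed_eq_interval)
      (use beta_strict_antimono[OF assms] in \<open>auto simp: le_less intro: less_trans\<close>)
  define i where "i = card ?A"
  have A': "1 \<le> j \<and> y < int (l j) - int j \<longleftrightarrow> 1 \<le> j \<and> j \<le> i" for j
  proof -
    have "j \<in> ?A \<longleftrightarrow> j \<in> {1..i}" using A unfolding i_def by (rule arg_cong)
    then show ?thesis by simp
  qed
  have "y \<noteq> int (l (i+1)) - int (i+1)" 
    using y unfolding beta_set_def by (metis (mono_tags, lifting) le_add2 mem_Collect_eq)
  with A'[of "i+1"] have up: "int (l (i+1)) - int (i+1) < y" by auto
  \<comment> \<open>Exactly \<open>i\<close> rows have a label above \<open>y\<close>, so the column
    with label \<open>y\<close> must have length \<open>i\<close>; then \<open>y = c - 1 - i\<close>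
    determines its index.\<close>
  define c where "c = nat (y + 1 + int i)"
  have c: "int c = y + 1 + int i" "1 \<le> c" "l (i+1) < c" using up unfolding c_def by auto
  have "\<not> i + 1 \<le> conj_partition l c"
    using le_conj_partition_iff[OF assms, of "i+1" c] c by simp
  moreover have "i \<le> conj_partition l c"
    using le_conj_partition_iff[OF assms, of i c] c A'[of i] by (cases "i = 0") auto
  ultimately have "conj_partition l c = i" by simp
  then show "\<exists>c\<ge>1. y = int c - 1 - int (conj_partition l c)"
    using c by (intro exI[of _ c]) auto
next
  assume "\<exists>c\<ge>1. y = int c - 1 - int (conj_partition l c)"
  then show "y \<notin> beta_set l"
    using beta_gt_cobeta_iff(2)[OF assms] unfolding beta_set_def by auto
qed

text \<open>Conjugation exchanges the two kinds of boundary steps and reverses the boundary, which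
  acts on labels as the reflection \<open>y \<mapsto> - 1 - y\<close>.\<close>

lemma beta_set_conj_partition:
  assumes "is_partition l"
  shows "y \<in> beta_set (conj_partition l) \<longleftrightarrow> - 1 - y \<notin> beta_set l"
proof -
  have "y = int (conj_partition l c) - int c \<longleftrightarrow> - 1 - y = int c - 1 - int (conj_partition l c)" for c
    by auto
  then show ?thesis
    unfolding not_in_beta_set_iff[OF assms] by (auto simp: beta_set_def)
qed

lemma card_beta_set_ge:
  assumes "is_partition l" "1 \<le> i"
  shows "finite {b \<in> beta_set l. b \<ge> int (l i) - int i}" "card {b \<in> beta_set l. b \<ge> int (l i) - int i} = i"
proof -
  let ?b = "\<lambda>j. int (l j) - int j"
  have eq: "{b \<in> beta_set l. b \<ge> ?b i} = ?b ` {1..i}"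
    using beta_less_iff[OF assms(1), of i] assms(2)

    by (force simp: beta_set_def not_less[symmetric] simp del: not_less)
  have "inj_on ?b {1..i}"
    by (intro linorder_inj_onI') (use beta_strict_antimono[OF assms(1)] in force)
  then show "finite {b \<in> beta_set l. b \<ge> ?b i}" "card {b \<in> beta_set l. b \<ge> ?b i} = i"
    unfolding eq by (auto simp: card_image)
qed

lemma beta_set_inj:
  assumes "is_partition l" "is_partition m" "beta_set l = beta_set m"
  shows "l = m"
proof
  \<comment> \<open>Each beta-set has exactly \<open>i\<close> elements from its \<open>i\<close>-th
    label upwards. If the \<open>i\<close>-th label of \<open>l\<close> were the smaller one, its
    upper part would contain that of \<open>m\<close> and one element more.\<close>
  have less: "\<not> int (l i) - int i < int (m i) - int i"
    if "is_partition l" "is_partition m" "beta_set l = beta_set m" "1 \<le> i" for i and l m :: "nat \<Rightarrow> nat"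
  proof
    assume *: "int (l i) - int i < int (m i) - int i"
    have "int (l i) - int i \<in> beta_set l" using that by (auto simp: beta_set_def)
    moreover have "int (l i) - int i \<notin> {b \<in> beta_set m. b \<ge> int (m i) - int i}" using * by auto
    moreover have "{b \<in> beta_set m. b \<ge> int (m i) - int i} \<subseteq> {b \<in> beta_set l. b \<ge> int (l i) - int i}"
      using that * by auto
    ultimately have "{b \<in> beta_set m. b \<ge> int (m i) - int i} \<subset> {b \<in> beta_set l. b \<ge> int (l i) - int i}"
      by blast
    from psubset_card_mono[OF card_beta_set_ge(1)[OF that(1,4)] this] show False
      using card_beta_set_ge(2)[OF that(1,4)] card_beta_set_ge(2)[OF that(2,4)] by simp
  qed
  fix i
  show "l i = m i"
    using less[of l m i] less[of m l i] assms
    by (cases "i = 0") (auto simp: is_partition_def)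
qed

section \<open>Self-conjugate cores as symmetric sets of integers\<close>

definition down_closed :: "nat \<Rightarrow> int set \<Rightarrow> bool" where
  "down_closed s B \<longleftrightarrow> (\<forall>b\<in>B. b - int s \<in> B)"

text \<open>A beta-set has as many elements from 0 on as it has gaps below 0. The reflection matches
  the former with the latter, so the balance is built into the symmetry; see
  \<open>sym_beta_charge\<close>.\<close>

definition sym_beta :: "int set \<Rightarrow> bool" where
  "sym_beta B \<longleftrightarrow> bdd_above B \<and> (\<forall>y. y \<in> B \<longleftrightarrow> - 1 - y \<notin> B)"

lemma sym_beta_iff: "sym_beta B \<Longrightarrow> - 1 - y \<in> B \<longleftrightarrow> y \<notin> B"
  unfolding sym_beta_def by blast

text \<open>The hook length at a cell is the label of its row minus the label \<open>?g c\<close> of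
  its column. A hook of length \<open>s\<close> is therefore an element \<open>b\<close> with
  \<open>b - s\<close> missing; as \<open>s\<close> is positive, the row label exceeds the column
  label, which puts the cell inside the diagram.\<close>

lemma cores_iff:
  assumes "s \<ge> 1"
  shows "l \<in> cores s \<longleftrightarrow> is_partition l \<and> down_closed s (beta_set l)"
proof (cases "is_partition l")
  case l: True
  let ?g = "\<lambda>c. int c - 1 - int (conj_partition l c)"
  have "(\<exists>(r, c)\<in>young_diagram l. hook_length l r c = int s) \<longleftrightarrow> (\<exists>b\<in>beta_set l. b - int s \<notin> beta_set l)"
  proof
    assume "\<exists>(r, c)\<in>young_diagram l. hook_length l r c = int s"
    then obtain r c where rc: "1 \<le> r" "1 \<le> c" "c \<le> l r" "hook_length l r c = int s"
      by (auto simp: young_diagram_def)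
    then have "int (l r) - int r - int s = ?g c" by (simp add: hook_length_def)
    then show "\<exists>b\<in>beta_set l. b - int s \<notin> beta_set l"
      using rc not_in_beta_set_iff[OF l] by (intro bexI[of _ "int (l r) - int r"]) (auto simp: beta_set_def)
  next
    assume "\<exists>b\<in>beta_set l. b - int s \<notin> beta_set l"
    then obtain i c where ic: "1 \<le> i" "1 \<le> c" "int (l i) - int i - int s = ?g c"
      unfolding not_in_beta_set_iff[OF l] by (auto simp: beta_set_def)
    then have "c \<le> l i"
      using beta_gt_cobeta_iff(1)[OF l, of i c] assms by auto
    then show "\<exists>(r, c)\<in>young_diagram l. hook_length l r c = int s"
      using ic by (intro bexI[of _ "(i, c)"]) (auto simp: young_diagram_def hook_length_def)
  qed
  then show ?thesis
    unfolding cores_def down_closed_def using l by blast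
qed (auto simp: cores_def)

lemma bdd_above_beta_set:
  assumes "is_partition l" shows "bdd_above (beta_set l)"
proof (rule bdd_aboveI)
  fix b assume "b \<in> beta_set l"
  then obtain i where "1 \<le> i" "b = int (l i) - int i" by (auto simp: beta_set_def)
  then show "b \<le> int (l 1)" using partition_antimono[OF assms, of 1 i] by auto
qed

lemma self_conj_cores_imp_sym_beta:
  assumes "s \<ge> 1" "l \<in> self_conj_cores s"
  shows "is_partition l" "sym_beta (beta_set l)" "down_closed s (beta_set l)"
proof -
  have "l \<in> cores s" and conj: "conj_partition l = l" using assms by (auto simp: self_conj_cores_def)
  then show l: "is_partition l" and "down_closed s (beta_set l)" using cores_iff[OF assms(1)] by auto
  show "sym_beta (beta_set l)"
    using beta_set_conj_partition[OF l] bdd_above_beta_set[OF l] unfolding sym_beta_def conj by blast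
qed

lemma sym_beta_above_finite:
  assumes "sym_beta B"
  shows "finite {b \<in> B. y \<le> b}" "finite {g. g \<notin> B \<and> g < y}"
proof -
  obtain M where M: "\<And>b. b \<in> B \<Longrightarrow> b \<le> M" using assms unfolding sym_beta_def bdd_above_def by blast
  then have "{b \<in> B. y \<le> b} \<subseteq> {y..M}" by auto
  then show "finite {b \<in> B. y \<le> b}" using finite_subset by blast
  have "- 1 - M \<le> g" if "g \<notin> B" for g using that M[of "-1-g"] sym_beta_iff[OF assms] by auto
  then have "{g. g \<notin> B \<and> g < y} \<subseteq> {-1-M..y}" by auto
  then show "finite {g. g \<notin> B \<and> g < y}" using finite_subset by blast
qed

text \<open>At height 0 this holds by symmetry, and both sides change in the same way from one height to
  the next.\<close>

lemma sym_beta_charge: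
  assumes "sym_beta B"
  shows "int (card {g. g \<notin> B \<and> g < y}) = y + int (card {b \<in> B. y \<le> b})"
proof -
  have step: "int (card {g. g \<notin> B \<and> g < y+1}) - int (card {b \<in> B. y+1 \<le> b}) =
      int (card {g. g \<notin> B \<and> g < y}) - int (card {b \<in> B. y \<le> b}) + 1" for y
  proof (cases "y \<in> B")
    have le_iff: "y \<le> b \<longleftrightarrow> b = y \<or> y + 1 \<le> b" and lt_iff: "b < y + 1 \<longleftrightarrow> b = y \<or> b < y" for b
      by linarith+
    case True
    then have "{b \<in> B. y \<le> b} = insert y {b \<in> B. y+1 \<le> b}"
      "{g. g \<notin> B \<and> g < y+1} = {g. g \<notin> B \<and> g < y}"
      using True unfolding le_iff lt_iff by blast+
    then show ?thesis using sym_beta_above_finite(1)[OF assms, of "y+1"] by simp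
  next
    have le_iff: "y \<le> b \<longleftrightarrow> b = y \<or> y + 1 \<le> b" and lt_iff: "b < y + 1 \<longleftrightarrow> b = y \<or> b < y" for b
      by linarith+
    case False
    then have "{g. g \<notin> B \<and> g < y+1} = insert y {g. g \<notin> B \<and> g < y}"
      "{b \<in> B. y \<le> b} = {b \<in> B. y+1 \<le> b}"
      using False unfolding le_iff lt_iff by blast+
    then show ?thesis using sym_beta_above_finite(2)[OF assms, of y] by simp
  qed
  have "bij_betw (\<lambda>y. - 1 - y) {b \<in> B. 0 \<le> b} {g. g \<notin> B \<and> g < 0}"
    by (rule bij_betw_byWitness[of _ "\<lambda>y. - 1 - y"]) (auto simp: sym_beta_iff[OF assms])
  then have base: "card {g. g \<notin> B \<and> g < 0} = card {b \<in> B. 0 \<le> b}"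
    by (simp add: bij_betw_same_card)
  show ?thesis
  proof (induction y rule: int_induct[of _ 0])
    case (step1 i)
    then show ?case using step[of i] by simp
  next
    case (step2 i)
    then show ?case using step[of "i - 1"] by simp
  qed (simp add: base)
qed

text \<open>Row \<open>i\<close> gets one cell for each non-element below the \<open>i\<close>-th
  largest element \<open>b\<close>. By \<open>sym_beta_charge\<close> there are \<open>b + i\<close>
  of these, so row \<open>i\<close> has the label \<open>b\<close>.\<close>

lemma sym_beta_imp_partition:
  assumes "sym_beta B"
  obtains l where "is_partition l" "conj_partition l = l" "beta_set l = B"
proof -
  \<comment> \<open>On elements of \<open>B\<close> this is the rank in decreasing order. A
    non-element \<open>g\<close> lies below the \<open>i\<close>-th largest element exactly when
    \<open>i \<le> p g\<close>.\<close>
  define p where "p y = card {b \<in> B. y \<le> b}" for y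
  obtain M where M: "\<And>b. b \<in> B \<Longrightarrow> b \<le> M" using assms unfolding sym_beta_def bdd_above_def by blast
  have low: "g \<in> B" if "g < - 1 - M" for g using that M[of "-1-g"] sym_beta_iff[OF assms] by auto
  have p_mono: "p y \<le> p x" if "x \<le> y" for x y
    unfolding p_def using that sym_beta_above_finite(1)[OF assms] by (intro card_mono) auto
  have p_step: "p y = (if y \<in> B then p (y+1) + 1 else p (y+1))" for y
  proof (cases "y \<in> B")
    have le_iff: "y \<le> b \<longleftrightarrow> b = y \<or> y + 1 \<le> b" for b by linarith
    case True
    then have "{b \<in> B. y \<le> b} = insert y {b \<in> B. y+1 \<le> b}" unfolding le_iff by blast
    then show ?thesis using True sym_beta_above_finite(1)[OF assms, of "y+1"] by (simp add: p_def)
  next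
    have le_iff: "y \<le> b \<longleftrightarrow> b = y \<or> y + 1 \<le> b" for b by linarith
    case False
    then have "{b \<in> B. y \<le> b} = {b \<in> B. y+1 \<le> b}" unfolding le_iff by blast
    then show ?thesis using False by (simp add: p_def)
  qed
  have p_ge: "p y \<ge> nat (- 1 - M - y)" for y
  proof -
    have "card {y..< - 1 - M} \<le> p y"
      unfolding p_def using low by (intro card_mono sym_beta_above_finite(1)[OF assms]) auto
    then show ?thesis by simp
  qed
  have p_0: "p y = 0" if "y > M" for y
  proof -
    have "{b \<in> B. y \<le> b} = {}" using M that by fastforce
    then show ?thesis unfolding p_def by (metis card.empty)
  qed
  define l where "l i = (if i = 0 then 0 else card {g. g \<notin> B \<and> i \<le> p g})" for i
  have l_eq: "int (l i) = b + int i" if "1 \<le> i" "b \<in> B" "p b = i" for i b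
  proof -
    have "i \<le> p g \<longleftrightarrow> g < b" if "g \<notin> B" for g
      using p_mono[of g b] p_mono[of "b+1" g] p_step[of b] \<open>b \<in> B\<close> \<open>p b = i\<close> that
      by (cases "g < b"; cases "g = b") auto
    then have "{g. g \<notin> B \<and> i \<le> p g} = {g. g \<notin> B \<and> g < b}" by blast
    then show ?thesis using sym_beta_charge[OF assms, of b] that by (simp add: l_def p_def)
  qed
  have ex: "\<exists>b\<in>B. p b = i" if "1 \<le> i" for i
  proof -
    \<comment> \<open>The lower bound makes the set finite but keeps it nonempty: everything below
      \<open>- 1 - M\<close> is in \<open>B\<close>, so the rank has reached \<open>i\<close> at the
      bound. Its maximum is the element of rank \<open>i\<close>.\<close>
    let ?A = "{y. - 1 - M - int i \<le> y \<and> i \<le> p y}"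
    have "?A \<subseteq> {- 1 - M - int i..M}"
      using p_0 that by (force intro: leI)
    then have fin: "finite ?A" using finite_subset by blast
    have A: "- 1 - M - int i \<in> ?A" using p_ge[of "- 1 - M - int i"] by simp
    define b where "b = Max ?A"
    have b: "b \<in> ?A" unfolding b_def using fin A by (intro Max_in) auto
    have "b + 1 \<notin> ?A" using Max_ge[OF fin, of "b+1"] unfolding b_def by linarith
    then show ?thesis using b p_step[of b] by (intro bexI[of _ b]) (auto split: if_splits)
  qed
  have beta: "beta_set l = B"
  proof
    show "beta_set l \<subseteq> B"
      using ex l_eq by (fastforce simp: beta_set_def)
    show "B \<subseteq> beta_set l"
    proof
      fix b assume "b \<in> B"
      moreover from this have "1 \<le> p b" using p_step[of b] by simp
      ultimately show "b \<in> beta_set l" using l_eq[of "p b" b] by (auto simp: beta_set_def intro!: exI[of _ "p b"])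
    qed
  qed
  have part: "is_partition l"
    unfolding is_partition_def
  proof (intro conjI)
    have fin: "finite {g. g \<notin> B \<and> i \<le> p g}" if "1 \<le> i" for i
    proof (rule finite_subset[of _ "{-1-M..M}"])
      show "{g. g \<notin> B \<and> i \<le> p g} \<subseteq> {-1-M..M}"
        using p_0 low that by (force intro: leI)
    qed simp
    show "antimono_on {1..} l"
      by (rule monotone_onI) (auto simp: l_def intro!: card_mono fin)
    have "l i = 0" if "i > p (- 1 - M)" for i
    proof -
      have "p g < i" if "g \<notin> B" for g
        using p_mono[of "-1-M" g] low[of g] that \<open>i > p (- 1 - M)\<close> by fastforce
      then have "{g. g \<notin> B \<and> i \<le> p g} = {}" by (auto simp: not_le)
      then show ?thesis unfolding l_def by (metis card.empty)
    qed
    then have "{i. l i \<noteq> 0} \<subseteq> {..p (- 1 - M)}" by (auto intro: leI)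
    then show "finite {i. l i \<noteq> 0}" using finite_subset by blast
  qed (simp add: l_def)
  have "beta_set (conj_partition l) = beta_set l"
    using beta_set_conj_partition[OF part] assms unfolding beta sym_beta_def by blast
  then show ?thesis
    using that beta_set_inj[OF is_partition_conj_partition[OF part] part] part beta by blast
qed

definition sym_cores :: "nat \<Rightarrow> int set set" where
  "sym_cores s = {B. sym_beta B \<and> down_closed s B}"

lemma bij_betw_beta_set:
  assumes "s \<ge> 1" shows "bij_betw beta_set (self_conj_cores s) (sym_cores s)"
proof (rule bij_betw_imageI)
  show "inj_on beta_set (self_conj_cores s)"
    using self_conj_cores_imp_sym_beta[OF assms] by (auto intro!: inj_onI beta_set_inj)
  show "beta_set ` self_conj_cores s = sym_cores s"
  proof
    show "beta_set ` self_conj_cores s \<subseteq> sym_cores s"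
      using self_conj_cores_imp_sym_beta[OF assms] by (auto simp: sym_cores_def)
    show "sym_cores s \<subseteq> beta_set ` self_conj_cores s"
    proof
      fix B assume B: "B \<in> sym_cores s"
      then obtain l where "is_partition l" "conj_partition l = l" "beta_set l = B"
        using sym_beta_imp_partition by (auto simp: sym_cores_def)
      then show "B \<in> beta_set ` self_conj_cores s"
        using B cores_iff[OF assms] by (auto simp: sym_cores_def self_conj_cores_def intro!: image_eqI[of _ _ l])
    qed
  qed
qed

text \<open>Once \<open>n\<close> is past the last nonzero part, the labels from \<open>- n\<close>
  upwards are those of the first \<open>n\<close> rows, and \<open>n * (n + 1)\<close> undoes the
  subtracted row indices. Leaving \<open>n\<close> free allows a cut-off at a multiple of
  \<open>t\<close> later.\<close>

lemma psize_eq_sum_beta_set: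
  assumes "is_partition l"
  obtains N where "\<And>n. n \<ge> N \<Longrightarrow> 2 * int (psize l) = 2 * (\<Sum>b | b \<in> beta_set l \<and> - int n \<le> b. b) + int n * (int n + 1)"
proof -
  obtain N where N: "\<And>i. i > N \<Longrightarrow> l i = 0" using partition_eventually_0[OF assms] by blast
  have "2 * int (psize l) = 2 * (\<Sum>b | b \<in> beta_set l \<and> - int n \<le> b. b) + int n * (int n + 1)" if "n \<ge> N" for n
  proof -
    let ?b = "\<lambda>j. int (l j) - int j"
    have "{b. b \<in> beta_set l \<and> - int n \<le> b} = ?b ` {1..n}"
    proof
      have "i \<le> n" if "- int n \<le> ?b i" for i
        using that N[of i] \<open>n \<ge> N\<close> by (cases "i > n") auto
      then show "{b. b \<in> beta_set l \<and> - int n \<le> b} \<subseteq> ?b ` {1..n}"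
        by (auto simp: beta_set_def)
    qed (auto simp: beta_set_def)
    moreover have "inj_on ?b {1..n}"
      by (intro linorder_inj_onI') (use beta_strict_antimono[OF assms(1)] in force)
    ultimately have "(\<Sum>b | b \<in> beta_set l \<and> - int n \<le> b. b) = (\<Sum>i=1..n. ?b i)"
      by (simp add: sum.reindex)
    also have "\<dots> = int (\<Sum>i=1..n. l i) - (\<Sum>i=1..n. int i)"
      by (simp add: sum_subtractf)
    also have "(\<Sum>i=1..n. l i) = psize l"
      unfolding psize_def
    proof (rule sum.mono_neutral_right)
      have "1 \<le> i \<and> i \<le> n" if "l i \<noteq> 0" for i
        using that N[of i] \<open>n \<ge> N\<close> assms by (cases "i = 0"; cases "i > n") (auto simp: is_partition_def)
      then show "{i. l i \<noteq> 0} \<subseteq> {1..n}" by auto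
    qed auto
    finally show ?thesis
      using double_gauss_sum_from_Suc_0[of n, where 'a=int] by (simp add: algebra_simps)
  qed
  then show ?thesis using that by blast
qed

section \<open>The runners of the abacus\<close>

text \<open>The smallest non-element of B congruent to y, where B is closed under subtraction of t. These
  are the elements of the t-set of the core with beta-set B.\<close>

definition gap :: "nat \<Rightarrow> int set \<Rightarrow> int \<Rightarrow> int" where
  "gap t B y = (THE m. m mod int t = y mod int t \<and> m \<notin> B \<and> m - int t \<in> B)"

lemma gap_cong: "y mod int t = z mod int t \<Longrightarrow> gap t B y = gap t B z"
  by (simp add: gap_def)

lemma down_closed_mult:
  assumes "down_closed t B" "y \<in> B" shows "y - int t * int k \<in> B"
proof (induction k)
  case (Suc k)
  then have "y - int t * int k - int t \<in> B" using assms(1) unfolding down_closed_def by blast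
  then show ?case by (simp add: algebra_simps)
qed (use assms in simp)

lemma down_closed_cong_le:
  assumes "down_closed t B" "y \<in> B" "x mod int t = y mod int t" "x \<le> y" shows "x \<in> B"
proof (cases "t = 0")
  case False
  have "int t dvd y - x" using assms(3) by (metis mod_eq_dvd_iff)
  then obtain k where k: "y - x = int t * k" by blast
  then have "k \<ge> 0" using assms(4) False by (metis diff_ge_0_iff_ge of_nat_0_less_iff neq0_conv zero_le_mult_iff not_le)
  then show ?thesis using down_closed_mult[OF assms(1,2), of "nat k"] k by (simp add: algebra_simps)
qed (use assms in simp)

lemma sym_beta_extremes:
  assumes "sym_beta B"
  obtains M where "M \<ge> 0" "\<And>y. y > M \<Longrightarrow> y \<notin> B" "\<And>y. y < - M \<Longrightarrow> y \<in> B"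
proof -
  obtain M where M: "\<And>b. b \<in> B \<Longrightarrow> b \<le> M" using assms unfolding sym_beta_def bdd_above_def by blast
  show ?thesis
  proof (rule that[of "\<bar>M\<bar> + 1"])
    show "y \<in> B" if "y < - (\<bar>M\<bar> + 1)" for y
      using sym_beta_iff[OF assms, of y] M[of "-1-y"] that by auto
    show "y \<notin> B" if "y > \<bar>M\<bar> + 1" for y
      using M[of y] that by auto
  qed simp
qed

context
  fixes t :: nat and B :: "int set"
  assumes t: "t \<ge> 1" and B: "B \<in> sym_cores t"
begin

text \<open>Each class modulo \<open>t\<close> meets \<open>B\<close> in a ray: closure under
  subtracting \<open>t\<close> makes it an initial segment, the bound makes it end, and the symmetry
  puts all very negative integers into \<open>B\<close>.\<close>

lemma ex1_gap: "\<exists>!m. m mod int t = y mod int t \<and> m \<notin> B \<and> m - int t \<in> B"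
proof (rule ex_ex1I)
  have "sym_beta B" using B by (simp add: sym_cores_def)
  then obtain M where M: "M \<ge> 0" "\<And>y. y > M \<Longrightarrow> y \<notin> B" "\<And>y. y < - M \<Longrightarrow> y \<in> B"
    using sym_beta_extremes by blast
  have t0: "0 < int t" using t by simp
  \<comment> \<open>Far enough down the runner of \<open>y\<close> to be below \<open>- M\<close>,
    and equally far from \<open>y\<close> on the other side after
    \<open>2 * (M + \<bar>y\<bar> + 1)\<close> steps, which is above \<open>M\<close>.\<close>
  define x where "x = y - int t * (M + \<bar>y\<bar> + 1)"
  define P where "P k \<longleftrightarrow> x + int t * int k \<notin> B" for k
  have big: "int t * (M + \<bar>y\<bar> + 1) \<ge> M + \<bar>y\<bar> + 1"
    using mult_right_mono[of 1 "int t" "M + \<bar>y\<bar> + 1"] M(1) t by simp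
  have "x < - M" unfolding x_def using big M(1) by linarith
  then have "\<not> P 0" using M(3) by (simp add: P_def)
  have "P (nat (2 * (M + \<bar>y\<bar> + 1)))"
  proof -
    have "x + int t * int (nat (2 * (M + \<bar>y\<bar> + 1))) = y + int t * (M + \<bar>y\<bar> + 1)"
      unfolding x_def using M(1) by (simp add: algebra_simps)
    also have "\<dots> > M" using big by linarith
    finally show ?thesis using M(2) unfolding P_def by blast
  qed
  then obtain k where k: "\<not> P k" "P (Suc k)"
    using \<open>\<not> P 0\<close> ex_least_nat_less[of P] by auto
  have "(x + int t * int (Suc k)) mod int t = y mod int t" unfolding x_def by (simp add: mod_simps algebra_simps mod_eq_dvd_iff)
  then show "\<exists>m. m mod int t = y mod int t \<and> m \<notin> B \<and> m - int t \<in> B"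
    using k unfolding P_def by (intro exI[of _ "x + int t * int (Suc k)"]) (auto simp: algebra_simps)
next
  fix m m'
  assume *: "m mod int t = y mod int t \<and> m \<notin> B \<and> m - int t \<in> B"
    "m' mod int t = y mod int t \<and> m' \<notin> B \<and> m' - int t \<in> B"
  have dc: "down_closed t B" using B by (simp add: sym_cores_def)
  have "m' > m - int t" "m > m' - int t"
    using down_closed_cong_le[OF dc, of "m - int t" m'] down_closed_cong_le[OF dc, of "m' - int t" m] *
    by (smt (verit) minus_mod_self2)+
  moreover have "int t dvd m - m'" using * by (metis mod_eq_dvd_iff)
  ultimately show "m = m'" using dvd_imp_le_int[of "m - m'" "int t"] by linarith
qed

lemma gap_mod: "gap t B y mod int t = y mod int t"
  and gap_notin: "gap t B y \<notin> B" and gap_minus_in: "gap t B y - int t \<in> B"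
  using theI'[OF ex1_gap, of y] unfolding gap_def by auto

lemma gap_eqI: "m mod int t = y mod int t \<Longrightarrow> m \<notin> B \<Longrightarrow> m - int t \<in> B \<Longrightarrow> gap t B y = m"
  using the1_equality[OF ex1_gap, of m y] unfolding gap_def by auto

text \<open>The gap function encodes the whole set, so equality of cores can be checked on
  gaps.\<close>

lemma mem_iff_less_gap: "y \<in> B \<longleftrightarrow> y < gap t B y"
proof
  have dc: "down_closed t B" using B by (simp add: sym_cores_def)
  show "y < gap t B y" if "y \<in> B"
    using down_closed_cong_le[OF dc that gap_mod[of y]] gap_notin[of y] by force
  show "y \<in> B" if "y < gap t B y"
  proof (rule down_closed_cong_le[OF dc gap_minus_in[of y]])
    show "y mod int t = (gap t B y - int t) mod int t" using gap_mod[of y] by simp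
    have "int t dvd gap t B y - y" using gap_mod[of y] by (metis mod_eq_dvd_iff)
    then show "y \<le> gap t B y - int t" using zdvd_imp_le[of "int t" "gap t B y - y"] that by auto
  qed
qed

text \<open>The reflection exchanges elements and non-elements, so the last element
  \<open>gap t B y - t\<close> of a runner becomes the first non-element of the mirrored
  runner.\<close>

lemma gap_minus: "gap t B (- 1 - y) = int t - 1 - gap t B y"
proof (rule gap_eqI)
  have sb: "sym_beta B" using B by (simp add: sym_cores_def)
  show "(int t - 1 - gap t B y) mod int t = (- 1 - y) mod int t"
    using gap_mod[of y] by (simp add: mod_eq_dvd_iff) (metis dvd_minus_iff minus_diff_eq mod_eq_dvd_iff diff_diff_eq2 add_diff_cancel_left' dvd_add_right_iff dvd_refl add_diff_eq diff_add_eq)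
  show "int t - 1 - gap t B y \<notin> B"
    using sym_beta_iff[OF sb, of "gap t B y - int t"] gap_minus_in[of y] by (simp add: algebra_simps)
  show "int t - 1 - gap t B y - int t \<in> B"
    using sym_beta_iff[OF sb, of "gap t B y"] gap_notin[of y] by (simp add: algebra_simps)
qed

lemma sum_gap: "2 * (\<Sum>r\<in>{0..<int t}. gap t B r) = int t * (int t - 1)"
proof -
  have "(\<Sum>r\<in>{0..<int t}. gap t B r) = (\<Sum>r\<in>{0..<int t}. gap t B (int t - 1 - r))"
    by (rule sum.reindex_bij_witness[of _ "\<lambda>r. int t - 1 - r" "\<lambda>r. int t - 1 - r"]) auto
  also have "\<dots> = (\<Sum>r\<in>{0..<int t}. int t - 1 - gap t B r)"
  proof (rule sum.cong[OF refl])
    fix r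
    have "gap t B (int t - 1 - r) = gap t B (- 1 - r)"
      by (rule gap_cong) (simp add: mod_eq_dvd_iff)
    then show "gap t B (int t - 1 - r) = int t - 1 - gap t B r" using gap_minus[of r] by simp
  qed
  also have "\<dots> = int t * (int t - 1) - (\<Sum>r\<in>{0..<int t}. gap t B r)"
    by (simp add: sum_subtractf)
  finally show ?thesis by simp
qed

end

section \<open>The size as a sum of squares over the runners\<close>

lemma sum_progression:
  fixes c d :: int
  shows "2 * d * (\<Sum>j<n. c + d * int j) = ((c + d * int n)\<^sup>2 - d * (c + d * int n)) - (c\<^sup>2 - d * c)"
  \<comment> \<open>The sum telescopes: \<open>2 * d * x\<close> is the increment of
    \<open>x\<^sup>2 - d * x\<close> from \<open>x\<close> to \<open>x + d\<close>.\<close>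
  by (induction n) (auto simp: algebra_simps power2_eq_square)

lemma sum_int_atLeastLessThan: "2 * (\<Sum>r\<in>{0..<int n}. r) = int n * (int n - 1)"
  "6 * (\<Sum>r\<in>{0..<int n}. r\<^sup>2) = int n * (int n - 1) * (2 * int n - 1)"
proof -
  have S: "{0..<int (Suc n)} = insert (int n) {0..<int n}" for n by auto
  show "2 * (\<Sum>r\<in>{0..<int n}. r) = int n * (int n - 1)"
  proof (induction n)
    case (Suc n)
    then show ?case unfolding S by (simp add: algebra_simps)
  qed simp
  show "6 * (\<Sum>r\<in>{0..<int n}. r\<^sup>2) = int n * (int n - 1) * (2 * int n - 1)"
  proof (induction n)
    case (Suc n)
    then show ?case unfolding S by (simp add: algebra_simps power2_eq_square)
  qed simp
qed

text \<open>The elements above a cut-off form one arithmetic progression per runner, and each is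
  summed in closed form. The subtracted term normalises the empty partition, whose gaps are
  \<open>0, ..., t - 1\<close>, to size 0.\<close>

lemma psize_eq_sum_gap:
  assumes t: "t \<ge> 1" and l: "is_partition l" and B: "beta_set l \<in> sym_cores t"
  shows "24 * int t * int (psize l) =
    3 * (\<Sum>r\<in>{0..<int t}. (2 * gap t (beta_set l) r - (int t - 1))\<^sup>2) - int t * ((int t)\<^sup>2 - 1)"
proof -
  define b where "b = gap t (beta_set l)"
  let ?R = "{0..<int t}"
  obtain N where N: "\<And>n. n \<ge> N \<Longrightarrow> 2 * int (psize l) =
      2 * (\<Sum>b | b \<in> beta_set l \<and> - int n \<le> b. b) + int n * (int n + 1)"
    using psize_eq_sum_beta_set[OF l] by blast
  \<comment> \<open>The cut-off \<open>- t * M\<close> is a multiple of \<open>t\<close>, so runner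
    \<open>r\<close> starts exactly at \<open>r - t * M\<close>; the second summand makes
    \<open>M\<close> so large that no runner has its gap below this start.\<close>
  define M where "M = N + (\<Sum>r\<in>?R. nat \<bar>b r - r\<bar>)"
  define S where "S = {y. y \<in> beta_set l \<and> - int (t * M) \<le> y}"
  have fin: "finite S"
  proof -
    have "sym_beta (beta_set l)" using B by (simp add: sym_cores_def)
    from sym_beta_above_finite(1)[OF this, of "- int (t * M)"] show ?thesis by (simp add: S_def)
  qed
  have "N \<le> M" by (simp add: M_def)
  also have "M \<le> t * M" using t by simp
  finally have "2 * int (psize l) = 2 * \<Sum>S + int (t * M) * (int (t * M) + 1)"
    using N by (simp add: S_def)
  then have 1: "2 * int t * int (psize l) = 2 * int t * \<Sum>S + int t * (int (t * M) * (int (t * M) + 1))"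
    by (simp add: algebra_simps)
  have "\<Sum>S = (\<Sum>r\<in>?R. \<Sum>y | y \<in> S \<and> y mod int t = r. y)"
    using fin t by (intro sum.group[symmetric]) auto
  then have "2 * int t * \<Sum>S = (\<Sum>r\<in>?R. 2 * int t * (\<Sum>y | y \<in> S \<and> y mod int t = r. y))"
    by (simp add: sum_distrib_left)
  also have "\<dots> = (\<Sum>r\<in>?R. ((b r)\<^sup>2 - int t * b r) - ((r - int t * int M)\<^sup>2 - int t * (r - int t * int M)))"
  proof (rule sum.cong[OF refl])
    fix r assume r: "r \<in> ?R"
    have "r mod int t = r" using r by simp
    then have "int t dvd b r - r" using gap_mod[OF t B, of r] unfolding b_def by (metis mod_eq_dvd_iff)
    then obtain k where k: "b r = r + int t * k" by (metis dvdE add_diff_cancel_left' diff_add_cancel add.commute)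
    have "nat \<bar>b r - r\<bar> \<le> M"
      unfolding M_def using member_le_sum[OF r, of "\<lambda>r. nat \<bar>b r - r\<bar>"] by simp
    moreover have "\<bar>k\<bar> \<le> \<bar>b r - r\<bar>" using k t by (simp add: abs_mult mult_le_cancel_right1)
    ultimately have kM: "k + int M \<ge> 0" by linarith
    define J where "J = nat (k + int M)"
    have bJ: "b r = (r - int t * int M) + int t * int J" using k kM by (simp add: J_def algebra_simps)
    have mem: "y \<in> beta_set l \<longleftrightarrow> y < b r" if "y mod int t = r" for y
      using mem_iff_less_gap[OF t B, of y] gap_cong[of y t r] that \<open>r mod int t = r\<close> unfolding b_def by simp
    have "{y. y \<in> S \<and> y mod int t = r} = (\<lambda>j. (r - int t * int M) + int t * int j) ` {..<J}"
    proof (intro equalityI subsetI)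
      fix y assume "y \<in> {y. y \<in> S \<and> y mod int t = r}"
      then have y: "y mod int t = r" "- int (t * M) \<le> y" "y < b r" using mem[of y] by (auto simp: S_def)
      define j where "j = y div int t + int M"
      have yj: "y = r - int t * int M + int t * j"
        using y(1) div_mult_mod_eq[of y "int t"] by (simp add: j_def algebra_simps)
      have "0 < int t * (j + 1)" using yj y(2) r by (simp add: algebra_simps)
      then have "j \<ge> 0" using t by (simp add: zero_less_mult_iff)
      have "int t * j < int t * int J" using yj y(3) bJ by simp
      then have "j < int J" using t by simp
      then show "y \<in> (\<lambda>j. (r - int t * int M) + int t * int j) ` {..<J}"
        using yj \<open>j \<ge> 0\<close> by (intro image_eqI[of _ _ "nat j"]) auto
    next
      fix y assume "y \<in> (\<lambda>j. (r - int t * int M) + int t * int j) ` {..<J}"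
      then obtain j where j: "j < J" "y = (r - int t * int M) + int t * int j" by blast
      have "(r - int t * int M + int t * int j) mod int t = r mod int t"
        by (simp add: mod_eq_dvd_iff algebra_simps)
      then have ym: "y mod int t = r" using j \<open>r mod int t = r\<close> by simp
      have "int t * int j < int t * int J" using j(1) t by simp
      then have "y < b r" using bJ j by simp
      moreover have "- int (t * M) \<le> y" using j r by simp
      ultimately show "y \<in> {y. y \<in> S \<and> y mod int t = r}" using ym mem by (simp add: S_def)
    qed
    moreover have "inj_on (\<lambda>j. (r - int t * int M) + int t * int j) {..<J}"
      using t by (auto intro!: inj_onI)
    ultimately have "(\<Sum>y | y \<in> S \<and> y mod int t = r. y) = (\<Sum>j<J. (r - int t * int M) + int t * int j)"
      by (simp add: sum.reindex)
    then show "2 * int t * (\<Sum>y | y \<in> S \<and> y mod int t = r. y) =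
        ((b r)\<^sup>2 - int t * b r) - ((r - int t * int M)\<^sup>2 - int t * (r - int t * int M))"
      using sum_progression[of "int t" "r - int t * int M" J] bJ by simp
  qed
  also have "\<dots> = (\<Sum>r\<in>?R. (b r)\<^sup>2) - int t * (\<Sum>r\<in>?R. b r)
      - ((\<Sum>r\<in>?R. r\<^sup>2) - (2 * int t * int M + int t) * (\<Sum>r\<in>?R. r) + int t * (int t * int M)\<^sup>2 + int t * int t * int t * int M)"
    by (simp add: sum.distrib sum_subtractf sum_distrib_left sum_distrib_right algebra_simps power2_eq_square)
  finally have 2: "2 * int t * \<Sum>S = \<dots>" .
  have "24 * int t * int (psize l) = 12 * (\<Sum>r\<in>?R. (b r)\<^sup>2) - 12 * int t * (\<Sum>r\<in>?R. b r)
      - (2 * (6 * (\<Sum>r\<in>?R. r\<^sup>2)) - 6 * (2 * int t * int M + int t) * (2 * (\<Sum>r\<in>?R. r))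
        + 12 * int t * (int t * int M)\<^sup>2 + 12 * int t * int t * int t * int M)
      + 12 * int t * (int (t * M) * (int (t * M) + 1))"
    using 1 2 by (simp add: algebra_simps)
  \<comment> \<open>All terms in the cut-off \<open>M\<close> cancel. The known sum of the gaps then
    completes the square.\<close>
  also have "\<dots> = 12 * (\<Sum>r\<in>?R. (b r)\<^sup>2) - 6 * int t * (2 * (\<Sum>r\<in>?R. b r)) - 2 * (int t * (int t - 1) * (2 * int t - 1)) + 6 * int t * (int t * (int t - 1))"
    unfolding sum_int_atLeastLessThan by (simp add: algebra_simps power2_eq_square)
  also have "\<dots> = 3 * (4 * (\<Sum>r\<in>?R. (b r)\<^sup>2) - 2 * (int t - 1) * (2 * (\<Sum>r\<in>?R. b r)) + int t * (int t - 1)\<^sup>2) - int t * ((int t)\<^sup>2 - 1)"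
    unfolding b_def sum_gap[OF t B] by (simp add: algebra_simps power2_eq_square power3_eq_cube)
  finally have 3: "24 * int t * int (psize l) = \<dots>" .
  have "(2 * b r - (int t - 1))\<^sup>2 = 4 * (b r)\<^sup>2 - 4 * (int t - 1) * b r + (int t - 1)\<^sup>2" for r
    by (simp add: power2_eq_square algebra_simps)
  then have "4 * (\<Sum>r\<in>?R. (b r)\<^sup>2) - 2 * (int t - 1) * (2 * (\<Sum>r\<in>?R. b r)) + int t * (int t - 1)\<^sup>2 =
      (\<Sum>r\<in>?R. (2 * b r - (int t - 1))\<^sup>2)"
    by (simp add: sum.distrib sum_subtractf sum_distrib_left[symmetric])
  then show ?thesis unfolding 3 by (simp add: b_def)
qed

section \<open>The affine hyperoctahedral group\<close>

definition aff_hyp :: "nat \<Rightarrow> (int \<Rightarrow> int) set" where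
  "aff_hyp s = {f. bij f \<and> (\<forall>m. f (m + int s) = f m + int s) \<and> (\<forall>m. f (- 1 - m) = - 1 - f m)}"

definition sset :: "nat \<Rightarrow> int set \<Rightarrow> int set" where
  "sset s B = (\<lambda>b. b + int s) ` B - B"

lemma mem_sset_iff: "y \<in> sset s B \<longleftrightarrow> y - int s \<in> B \<and> y \<notin> B"
  by (force simp: sset_def image_iff)

lemma periodic_mult:
  fixes f :: "int \<Rightarrow> int"
  assumes "\<And>m. f (m + d) = f m + d"
  shows "f (m + d * k) = f m + d * k"
proof (induction k rule: int_induct[of _ 0])
  case (step1 i)
  then show ?case using assms[of "m + d * i"] by (simp add: algebra_simps)
next
  case (step2 i)
  then show ?case using assms[of "m + d * (i - 1)"] by (simp add: algebra_simps)
qed simp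

lemma periodic_div_mod:
  fixes f :: "int \<Rightarrow> int"
  assumes "\<And>m. f (m + d) = f m + d"
  shows "f m = f (m mod d) + d * (m div d)"
  using periodic_mult[of f d "m mod d" "m div d", OF assms] by simp

lemma hypD:
  assumes "f \<in> aff_hyp s"
  shows "bij f" "f (m + int s) = f m + int s" "f (- 1 - m) = - 1 - f m"
  using assms by (auto simp: aff_hyp_def)

lemma hyp_reflect: "f \<in> aff_hyp s \<Longrightarrow> f (int s - 1 - m) = int s - 1 - f m"
  using hypD(2)[of f s "- 1 - m"] hypD(3)[of f s m] by (simp add: algebra_simps)

lemma hyp_div_mod: "f \<in> aff_hyp s \<Longrightarrow> f m = f (m mod int s) + int s * (m div int s)"
  by (rule periodic_div_mod) (rule hypD(2))

lemma id_hyp: "id \<in> aff_hyp s"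
  by (auto simp: aff_hyp_def)

lemma comp_hyp: "f \<in> aff_hyp s \<Longrightarrow> g \<in> aff_hyp s \<Longrightarrow> f \<circ> g \<in> aff_hyp s"
  by (auto simp: aff_hyp_def bij_comp)

lemma inv_hyp: assumes "f \<in> aff_hyp s" shows "inv_into UNIV f \<in> aff_hyp s"
proof -
  have f: "f (inv_into UNIV f m) = m" for m using hypD(1)[OF assms] by (simp add: bij_is_surj surj_f_inv_f)
  have inj: "inj f" using hypD(1)[OF assms] by (rule bij_is_inj)
  have "inv_into UNIV f (m + int s) = inv_into UNIV f m + int s" "inv_into UNIV f (- 1 - m) = - 1 - inv_into UNIV f m" for m
    using hypD(2,3)[OF assms] f by (auto intro!: inv_f_eq[OF inj])
  then show ?thesis using hypD(1)[OF assms] by (simp add: aff_hyp_def bij_imp_bij_inv)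
qed

text \<open>The images of \<open>i\<close> and \<open>s - 1 - i\<close> add up to
  \<open>s - 1\<close>, so pairing the window with its reflection yields the sum
  \<open>s choose 2\<close>.\<close>

lemma carrier_H_group: "carrier (H_group s t) = {f \<in> aff_hyp s. \<forall>m. [f m = m] (mod int t)}"
proof -
  have "(\<Sum>i = 0..<int s. f i) = int (s choose 2)" if f: "f \<in> aff_hyp s" for f
  proof -
    have "(\<Sum>i = 0..<int s. f i) = (\<Sum>i = 0..<int s. f (int s - 1 - i))"
      by (rule sum.reindex_bij_witness[of _ "\<lambda>i. int s - 1 - i" "\<lambda>i. int s - 1 - i"]) auto
    also have "\<dots> = int s * (int s - 1) - (\<Sum>i = 0..<int s. f i)"
      by (simp add: hyp_reflect[OF f] sum_subtractf)
    finally have "2 * (\<Sum>i = 0..<int s. f i) = int s * (int s - 1)" by simp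
    moreover have "2 * int (s choose 2) = int s * (int s - 1)"
      by (cases s) (simp_all add: choose_two zdiv_int algebra_simps)
    ultimately show ?thesis by simp
  qed
  then show ?thesis unfolding H_group_def aff_hyp_def by auto
qed

lemma mem_image_hyp: "f \<in> aff_hyp s \<Longrightarrow> f m \<in> f ` B \<longleftrightarrow> m \<in> B"
  using hypD(1) by (simp add: bij_is_inj inj_image_mem_iff)

lemma sset_image: assumes "f \<in> aff_hyp s" shows "sset s (f ` B) = f ` sset s B"
proof -
  have "(\<lambda>b. b + int s) ` f ` B = f ` (\<lambda>b. b + int s) ` B"
    using hypD(2)[OF assms] by (simp add: image_image)
  then show ?thesis
    unfolding sset_def using hypD(1)[OF assms] by (simp add: image_set_diff bij_is_inj)
qed

lemma image_sym_cores:
  assumes "s \<ge> 1" "f \<in> aff_hyp s" "B \<in> sym_cores s"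
  shows "f ` B \<in> sym_cores s"
proof -
  have sb: "sym_beta B" and dc: "down_closed s B" using assms(3) by (auto simp: sym_cores_def)
  note f = hypD[OF assms(2)]
  obtain M where M: "\<And>b. b \<in> B \<Longrightarrow> b \<le> M" using sb unfolding sym_beta_def bdd_above_def by blast
  have "bdd_above (f ` B)"
  proof (rule bdd_aboveI2)
    fix b assume "b \<in> B"
    \<comment> \<open>The displacement \<open>f m - m\<close> depends only on
      \<open>m mod s\<close>, hence is bounded.\<close>
    have "f b = f (b mod int s) + int s * (b div int s)" using hyp_div_mod[OF assms(2)] .
    also have "f (b mod int s) \<le> \<bar>f (b mod int s)\<bar>" by simp
    also have "\<bar>f (b mod int s)\<bar> \<le> (\<Sum>i\<in>{0..<int s}. \<bar>f i\<bar>)"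
      using assms(1) by (intro member_le_sum) auto
    also have "int s * (b div int s) = b - b mod int s" by (simp add: minus_mod_eq_mult_div)
    also have "\<dots> \<le> M" using M[OF \<open>b \<in> B\<close>] assms(1) by (smt (verit) pos_mod_sign of_nat_0_less_iff less_le_trans zero_less_one)
    finally show "f b \<le> (\<Sum>i\<in>{0..<int s}. \<bar>f i\<bar>) + M" by simp
  qed
  moreover have "y \<in> f ` B \<longleftrightarrow> - 1 - y \<notin> f ` B" for y
  proof -
    obtain m where m: "y = f m" using f(1) by (meson bij_is_surj surjD)
    then have "- 1 - y = f (- 1 - m)" using f(3) by simp
    then show ?thesis using m mem_image_hyp[OF assms(2)] sym_beta_iff[OF sb] by simp
  qed
  ultimately have "sym_beta (f ` B)" unfolding sym_beta_def by blast
  moreover have "f b - int s \<in> f ` B" if "b \<in> B" for b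
  proof -
    have "f b - int s = f (b - int s)" using f(2)[of "b - int s"] by simp
    moreover have "b - int s \<in> B" using dc that unfolding down_closed_def by blast
    ultimately show ?thesis by simp
  qed
  then have "down_closed s (f ` B)" by (auto simp: down_closed_def)
  ultimately show ?thesis by (simp add: sym_cores_def)
qed

lemma negatives_sym_cores: "{..<0} \<in> sym_cores s"
  by (auto simp: sym_cores_def sym_beta_def down_closed_def)

text \<open>The elements of the s-set are precisely the gaps modulo \<open>s\<close>, so it
  determines the gap function and with it the set.\<close>

lemma sset_inj:
  assumes "s \<ge> 1" "B \<in> sym_cores s" "C \<in> sym_cores s" "sset s B = sset s C"
  shows "B = C"
proof -
  have "gap s D y = (THE m. m mod int s = y mod int s \<and> m \<in> sset s D)" for D y
    unfolding gap_def by (rule arg_cong[of _ _ The]) (auto simp: mem_sset_iff)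
  then have "gap s B = gap s C" using assms(4) by auto
  then show ?thesis
    using mem_iff_less_gap[OF assms(1,2)] mem_iff_less_gap[OF assms(1,3)] by auto
qed

text \<open>Resolves the definite description in \<open>core_action\<close>: on beta-sets the action
  is the image under \<open>f\<close>, since this image is again a symmetric core with the required
  s-set.\<close>

lemma core_action_fixes_iff:
  assumes s: "s \<ge> 1" and l: "l \<in> self_conj_cores s" and f: "f \<in> aff_hyp s"
  shows "core_action s f l = l \<longleftrightarrow> f ` beta_set l = beta_set l"
proof -
  have bij: "bij_betw beta_set (self_conj_cores s) (sym_cores s)" using s by (rule bij_betw_beta_set)
  have B: "beta_set l \<in> sym_cores s" using bij l by (rule bij_betwE[rule_format])
  have C: "f ` beta_set l \<in> sym_cores s" using image_sym_cores[OF s f B] .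
  then obtain m where m: "m \<in> self_conj_cores s" "beta_set m = f ` beta_set l"
    using bij by (metis bij_betw_imp_surj_on imageE)
  have s_set: "s_set s l = sset s (beta_set l)" for l by (simp add: s_set_def sset_def)
  have "s_set s n = f ` s_set s l \<longleftrightarrow> n = m" if n: "n \<in> self_conj_cores s" for n
  proof -
    have nB: "beta_set n \<in> sym_cores s" using bij n by (rule bij_betwE[rule_format])
    have "s_set s n = f ` s_set s l \<longleftrightarrow> sset s (beta_set n) = sset s (f ` beta_set l)"
      by (simp add: s_set sset_image[OF f])
    also have "\<dots> \<longleftrightarrow> beta_set n = beta_set m"
      using sset_inj[OF s nB C] m(2) by auto
    also have "\<dots> \<longleftrightarrow> n = m"
      using bij_betw_imp_inj_on[OF bij] n m(1) by (auto dest: inj_onD)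
    finally show ?thesis .
  qed
  then have "core_action s f l = m"
    unfolding core_action_def using m(1) by (intro the_equality) auto
  moreover have "m = l \<longleftrightarrow> beta_set m = beta_set l"
    using bij_betw_imp_inj_on[OF bij] l m(1) by (auto dest: inj_onD)
  ultimately show ?thesis using m(2) by simp
qed

definition stab :: "nat \<Rightarrow> nat \<Rightarrow> int set \<Rightarrow> (int \<Rightarrow> int) set" where
  "stab s t B = {h \<in> aff_hyp s. (\<forall>m. [h m = m] (mod int t)) \<and> h ` B = B}"

lemma stabilizer_eq_stab:
  assumes "s \<ge> 1" "l \<in> self_conj_cores s"
  shows "stabilizer (H_group s t) (core_action s) l = stab s t (beta_set l)"
  using core_action_fixes_iff[OF assms] by (auto simp: stabilizer_def carrier_H_group stab_def)

text \<open>The s-set has one element in each class modulo \<open>s\<close>, so an injection of the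
  window into it meets every class once, and periodicity extends this to a bijection. Moreover
  \<open>f m\<close> differs from the gap of its runner by \<open>s * (m div s)\<close>, which is
  negative exactly for negative \<open>m\<close>.\<close>

lemma window_bij:
  fixes f :: "int \<Rightarrow> int"
  assumes s: "s \<ge> 1" and B: "B \<in> sym_cores s"
    and per: "\<And>m. f (m + int s) = f m + int s"
    and S: "\<And>i. i \<in> {0..<int s} \<Longrightarrow> f i \<in> sset s B"
    and inj: "inj_on f {0..<int s}"
  shows "bij f" "f ` {..<0} = B"
proof -
  have s0: "0 < int s" using s by simp
  have gap_f: "gap s B (f i) = f i" if "i \<in> {0..<int s}" for i
    using S[OF that] by (intro gap_eqI[OF s B]) (auto simp: mem_sset_iff)
  have "inj_on (\<lambda>i. f i mod int s) {0..<int s}"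
  proof (rule inj_onI)
    fix i j assume ij: "i \<in> {0..<int s}" "j \<in> {0..<int s}" "f i mod int s = f j mod int s"
    then have "f i = f j" using gap_f gap_cong by metis
    then show "i = j" using inj ij by (auto dest: inj_onD)
  qed
  then have surj: "(\<lambda>i. f i mod int s) ` {0..<int s} = {0..<int s}"
    using s0 by (intro endo_inj_surj) auto
  have win: "m mod int s \<in> {0..<int s}" for m using s0 by simp
  have fm: "f m = f (m mod int s) + int s * (m div int s)" for m using periodic_div_mod[of f "int s"] per by blast
  have gap_fm: "gap s B (f m) = f (m mod int s)" for m
  proof -
    have "gap s B (f m) = gap s B (f (m mod int s))"
      by (rule gap_cong) (use fm[of m] in simp)
    then show ?thesis using gap_f[OF win] by simp
  qed
  show "bij f"
  proof (rule bijI)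
    show "inj f"
    proof (rule injI)
      fix m n assume *: "f m = f n"
      then have "f (m mod int s) = f (n mod int s)" using gap_fm by metis
      then have "m mod int s = n mod int s" using inj win by (auto dest: inj_onD)
      moreover have "m div int s = n div int s" using fm[of m] fm[of n] * calculation s0 by simp
      ultimately show "m = n" by (metis div_mult_mod_eq)
    qed
    show "surj f"
    proof (rule surjI[of _ "\<lambda>y. SOME m. f m = y"])
      fix y
      have "y mod int s \<in> (\<lambda>i. f i mod int s) ` {0..<int s}" using surj win by simp
      then obtain i where "f i mod int s = y mod int s" by auto
      then obtain k where "y = f i + int s * k" by (metis mod_eqE)
      then have "f (i + int s * k) = y" using periodic_mult[of f "int s" i k] per by simp
      then show "f (SOME m. f m = y) = y" by (rule someI)
    qed
  qed
  have "f m \<in> B \<longleftrightarrow> m < 0" for m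
  proof -
    have "f m \<in> B \<longleftrightarrow> int s * (m div int s) < 0"
      using mem_iff_less_gap[OF s B, of "f m"] gap_fm[of m] fm[of m] by simp
    also have "\<dots> \<longleftrightarrow> m < 0" using s0 by (simp add: mult_less_0_iff pos_imp_zdiv_neg_iff)
    finally show ?thesis .
  qed
  then show "f ` {..<0} = B" using \<open>bij f\<close> by (force simp: bij_def surj_def)
qed

lemma div_minus_one_minus:
  assumes "d > 0" shows "(- 1 - m) div d = - 1 - m div (d :: int)"
proof -
  have "- 1 - m = d * (- 1 - m div d) + (d - 1 - m mod d)"
    using mult_div_mod_eq[of d m] by (simp add: algebra_simps)
  moreover have "0 \<le> d - 1 - m mod d" "d - 1 - m mod d < d" 
    using pos_mod_sign[OF assms, of m] pos_mod_bound[OF assms, of m] by linarith+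
  ultimately show ?thesis by (metis int_div_pos_eq)
qed

text \<open>Among the elements with image \<open>B\<close>, the one preserving all classes modulo
  \<open>s\<close> is taken: it sends each window position to the gap of its own class.\<close>

lemma hyp_transitive:
  assumes s: "s \<ge> 1" and B: "B \<in> sym_cores s"
  obtains f where "f \<in> aff_hyp s" "f ` {..<0} = B"
proof -
  have s0: "0 < int s" using s by simp
  define f where "f m = gap s B m + int s * (m div int s)" for m
  have per: "f (m + int s) = f m + int s" for m
    using gap_cong[of "m + int s" s m B] s0 by (simp add: f_def algebra_simps)
  have S: "f i \<in> sset s B" "f i mod int s = i" if "i \<in> {0..<int s}" for i
    using that gap_notin[OF s B, of i] gap_minus_in[OF s B, of i] gap_mod[OF s B, of i]
    by (simp_all add: f_def mem_sset_iff)
  have "inj_on f {0..<int s}" by (rule inj_onI) (metis S(2))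
  note win = window_bij[OF s B per S(1) this]
  moreover have "f (- 1 - m) = - 1 - f m" for m
    unfolding f_def gap_minus[OF s B, of m] div_minus_one_minus[OF s0, of m] by (simp add: algebra_simps)
  ultimately have "f \<in> aff_hyp s" using per by (simp add: aff_hyp_def)
  then show ?thesis using that win(2) by blast
qed

lemma hyp_eqI:
  assumes "s \<ge> 1" "f \<in> aff_hyp s" "g \<in> aff_hyp s" "\<And>i. i \<in> {0..<int s} \<Longrightarrow> f i = g i"
  shows "f = g"
proof
  fix m
  have "f m = f (m mod int s) + int s * (m div int s)" "g m = g (m mod int s) + int s * (m div int s)"
    using hyp_div_mod assms(2,3) by blast+
  then show "f m = g m" using assms(1,4) by simp
qed

lemma bij_betw_fibre:
  assumes "f \<in> aff_hyp s"
  shows "bij_betw (\<lambda>g. f \<circ> g) {g \<in> aff_hyp s. g ` {..<0} = {..<0}} {g \<in> aff_hyp s. g ` {..<0} = f ` {..<0}}"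
proof (rule bij_betw_byWitness[of _ "\<lambda>g. inv_into UNIV f \<circ> g"])
  have f: "bij f" using hypD(1)[OF assms] .
  show "\<forall>g\<in>{g \<in> aff_hyp s. g ` {..<0} = {..<0}}. inv_into UNIV f \<circ> (f \<circ> g) = g"
    using f by (auto simp: o_assoc[symmetric] bij_def inv_o_cancel fun_eq_iff)
  show "\<forall>g\<in>{g \<in> aff_hyp s. g ` {..<0} = f ` {..<0}}. f \<circ> (inv_into UNIV f \<circ> g) = g"
    using f by (auto simp: bij_is_surj surj_f_inv_f fun_eq_iff)
  show "(\<lambda>g. f \<circ> g) ` {g \<in> aff_hyp s. g ` {..<0} = {..<0}} \<subseteq> {g \<in> aff_hyp s. g ` {..<0} = f ` {..<0}}"
  proof (rule image_subsetI)
    fix g assume "g \<in> {g \<in> aff_hyp s. g ` {..<0} = {..<0}}"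
    moreover have "(f \<circ> g) ` {..<0} = f ` g ` {..<0}" by (simp only: image_comp)
    ultimately show "f \<circ> g \<in> {g \<in> aff_hyp s. g ` {..<0} = f ` {..<0}}"
      using assms comp_hyp by simp
  qed
  show "(\<lambda>g. inv_into UNIV f \<circ> g) ` {g \<in> aff_hyp s. g ` {..<0} = f ` {..<0}} \<subseteq> {g \<in> aff_hyp s. g ` {..<0} = {..<0}}"
  proof (rule image_subsetI)
    fix g assume "g \<in> {g \<in> aff_hyp s. g ` {..<0} = f ` {..<0}}"
    moreover have "(inv_into UNIV f \<circ> g) ` {..<0} = inv_into UNIV f ` g ` {..<0}" by (simp only: image_comp)
    ultimately show "inv_into UNIV f \<circ> g \<in> {g \<in> aff_hyp s. g ` {..<0} = {..<0}}"
      using assms comp_hyp inv_hyp image_inv_f_f[OF bij_is_inj[OF f], of "{..<0}"] by simp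
  qed
qed

text \<open>An element that preserves the negatives also preserves their s-set, the window itself,
  and is determined by the permutation it induces there.\<close>

lemma finite_parabolic:
  assumes s: "s \<ge> 1" shows "finite {g \<in> aff_hyp s. g ` {..<0} = {..<0}}" (is "finite ?W")
proof (rule inj_on_finite[of "\<lambda>g. restrict g {0..<int s}"])
  have "sset s {..<0} = {0..<int s}" by (auto simp: mem_sset_iff)
  then have win: "g ` {0..<int s} = {0..<int s}" if "g \<in> ?W" for g
    using sset_image[of g s "{..<0}"] that by auto
  show "inj_on (\<lambda>g. restrict g {0..<int s}) ?W"
  proof (rule inj_onI)
    fix f g assume *: "f \<in> ?W" "g \<in> ?W" "restrict f {0..<int s} = restrict g {0..<int s}"
    show "f = g"
      by (rule hyp_eqI[OF s]) (use * in \<open>auto dest!: fun_cong split: if_splits simp: restrict_def\<close>)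
  qed
  show "(\<lambda>g. restrict g {0..<int s}) ` ?W \<subseteq> {0..<int s} \<rightarrow>\<^sub>E {0..<int s}"
    using win by fastforce
  show "finite ({0..<int s} \<rightarrow>\<^sub>E {0..<int s})" by (simp add: finite_PiE)
qed

lemma finite_fibre:
  assumes "s \<ge> 1" "B \<in> sym_cores s"
  shows "finite {g \<in> aff_hyp s. g ` {..<0} = B}"
    "card {g \<in> aff_hyp s. g ` {..<0} = B} = card {g \<in> aff_hyp s. g ` {..<0} = {..<0}}"
proof -
  obtain f where "f \<in> aff_hyp s" "f ` {..<0} = B" using hyp_transitive[OF assms] by blast
  then have "bij_betw (\<lambda>g. f \<circ> g) {g \<in> aff_hyp s. g ` {..<0} = {..<0}} {g \<in> aff_hyp s. g ` {..<0} = B}"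
    using bij_betw_fibre by blast
  then show "finite {g \<in> aff_hyp s. g ` {..<0} = B}"
    "card {g \<in> aff_hyp s. g ` {..<0} = B} = card {g \<in> aff_hyp s. g ` {..<0} = {..<0}}"
    using finite_parabolic[OF assms(1)] by (auto simp: bij_betw_finite bij_betw_same_card)
qed

section \<open>Residue patterns and stabilizers\<close>

definition residues_of :: "nat \<Rightarrow> nat \<Rightarrow> (int \<Rightarrow> int) \<Rightarrow> int \<Rightarrow> int" where
  "residues_of s t f = restrict (\<lambda>i. f i mod int t) {0..<int (s div 2)}"

text \<open>The reflection carries the congruence from the first half to the second, and periodicity
  carries it from the window to all integers, since both values change by the same multiple of
  \<open>s\<close>.\<close>

lemma residues_of_eqD:
  assumes s: "s \<ge> 1" and f: "f \<in> aff_hyp s" and g: "g \<in> aff_hyp s" and eq: "residues_of s t f = residues_of s t g"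
  shows "[f m = g m] (mod int t)"
proof -
  have low: "[f i = g i] (mod int t)" if "i \<in> {0..<int (s div 2)}" for i
    using fun_cong[OF eq, of i] that by (simp add: residues_of_def cong_def)
  have win: "[f i = g i] (mod int t)" if i: "i \<in> {0..<int s}" for i
  proof -
    consider "i < int (s div 2)" | "int s - 1 - i < int (s div 2)" | "2 * i = int s - 1" by linarith
    then show ?thesis
    proof cases
      case 1
      then show ?thesis using low i by simp
    next
      case 2
      then have "[f (int s - 1 - i) = g (int s - 1 - i)] (mod int t)" using low i by simp
      then have "[int s - 1 - f (int s - 1 - i) = int s - 1 - g (int s - 1 - i)] (mod int t)"
        by (rule cong_diff[OF cong_refl])
      then show ?thesis by (simp add: hyp_reflect[OF f] hyp_reflect[OF g])
    next
      case 3
      \<comment> \<open>The middle position is its own mirror image, so both maps fix it.\<close>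
      then have "int s - 1 - i = i" by simp
      then have "f i = g i" using hyp_reflect[OF f, of i] hyp_reflect[OF g, of i] by simp
      then show ?thesis by simp
    qed
  qed
  have "f m = f (m mod int s) + int s * (m div int s)" "g m = g (m mod int s) + int s * (m div int s)"
    using hyp_div_mod f g by blast+
  then show ?thesis using win[of "m mod int s"] s by (simp add: cong_add_rcancel)
qed

text \<open>Equal residues mean that \<open>h = g \<circ> inv f\<close> is congruent to the identity
  at every point \<open>f m\<close>, hence everywhere; equal images mean that \<open>h\<close> fixes
  the common image.\<close>

lemma bij_betw_stab:
  assumes s: "s \<ge> 1" and f: "f \<in> aff_hyp s"
  shows "bij_betw (\<lambda>h. h \<circ> f) (stab s t (f ` {..<0}))
    {g \<in> aff_hyp s. g ` {..<0} = f ` {..<0} \<and> residues_of s t g = residues_of s t f}"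
proof (rule bij_betw_byWitness[of _ "\<lambda>g. g \<circ> inv_into UNIV f"])
  have bij: "bij f" using hypD(1)[OF f] .
  then have inv: "f (inv_into UNIV f m) = m" "inv_into UNIV f (f m) = m" for m
    by (simp_all add: bij_is_surj surj_f_inv_f bij_is_inj)
  show "\<forall>h\<in>stab s t (f ` {..<0}). h \<circ> f \<circ> inv_into UNIV f = h" using inv by (auto simp: fun_eq_iff)
  show "\<forall>g\<in>{g \<in> aff_hyp s. g ` {..<0} = f ` {..<0} \<and> residues_of s t g = residues_of s t f}. g \<circ> inv_into UNIV f \<circ> f = g"
    using inv by (auto simp: fun_eq_iff)
  show "(\<lambda>h. h \<circ> f) ` stab s t (f ` {..<0}) \<subseteq>
      {g \<in> aff_hyp s. g ` {..<0} = f ` {..<0} \<and> residues_of s t g = residues_of s t f}"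
  proof (rule image_subsetI)
    fix h assume h: "h \<in> stab s t (f ` {..<0})"
    then have "residues_of s t (h \<circ> f) = residues_of s t f"
      by (simp add: stab_def residues_of_def cong_def)
    then show "h \<circ> f \<in> {g \<in> aff_hyp s. g ` {..<0} = f ` {..<0} \<and> residues_of s t g = residues_of s t f}"
      using h f comp_hyp unfolding stab_def by (simp only: image_comp[symmetric] mem_Collect_eq)
  qed
  show "(\<lambda>g. g \<circ> inv_into UNIV f) ` {g \<in> aff_hyp s. g ` {..<0} = f ` {..<0} \<and> residues_of s t g = residues_of s t f}
      \<subseteq> stab s t (f ` {..<0})"
  proof (rule image_subsetI)
    fix g assume "g \<in> {g \<in> aff_hyp s. g ` {..<0} = f ` {..<0} \<and> residues_of s t g = residues_of s t f}"
    then have g: "g \<in> aff_hyp s" "g ` {..<0} = f ` {..<0}" "residues_of s t g = residues_of s t f" by simp_all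
    define h where "h = g \<circ> inv_into UNIV f"
    have "[h m = m] (mod int t)" for m
      using residues_of_eqD[OF s g(1) f g(3), of "inv_into UNIV f m"] inv by (simp add: h_def)
    moreover have "h \<circ> f = g" by (simp add: h_def fun_eq_iff inv)
    then have "h ` f ` {..<0} = f ` {..<0}" using g(2) by (simp only: image_comp)
    moreover have "h \<in> aff_hyp s" unfolding h_def by (intro comp_hyp inv_hyp g(1) f)
    ultimately show "g \<circ> inv_into UNIV f \<in> stab s t (f ` {..<0})"
      by (simp add: stab_def h_def)
  qed
qed

section \<open>The cores with a given residue pattern\<close>

definition cnt :: "nat \<Rightarrow> nat \<Rightarrow> (int \<Rightarrow> int) \<Rightarrow> int \<Rightarrow> nat" where
  "cnt s t x r = card {i \<in> {0..<int s}. x i mod int t = r mod int t}"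

lemma ex_cong_minus_mult:
  fixes r r' :: int
  assumes "coprime s t" "t \<ge> 1"
  obtains k :: nat where "k < t" "(r - int s * int k) mod int t = r' mod int t"
proof -
  have "coprime (int s) (int t)" using assms(1) by simp
  then obtain u where "[int s * u = 1] (mod int t)" using cong_solve_coprime_int by blast
  then have "[int s * u * (r - r') = 1 * (r - r')] (mod int t)" by (rule cong_scalar_right)
  moreover have "[int s * ((u * (r - r')) mod int t) = int s * (u * (r - r'))] (mod int t)"
    by (simp add: cong_def mod_mult_right_eq)
  ultimately have "[int s * ((u * (r - r')) mod int t) = r - r'] (mod int t)"
    by (simp add: cong_def mult.assoc)
  then have "[r - int s * ((u * (r - r')) mod int t) = r - (r - r')] (mod int t)"
    by (rule cong_diff[OF cong_refl])
  then show ?thesis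
    using that[of "nat ((u * (r - r')) mod int t)"] assms(2) by (simp add: cong_def nat_less_iff)
qed

text \<open>The elements of the s-set congruent to r modulo t form the progression with difference t that
  starts at the gap of r and stops before s plus the gap of r - s.\<close>

lemma gap_minus_s:
  assumes s: "s \<ge> 1" and t: "t \<ge> 1" and f: "f \<in> aff_hyp s" and B: "f ` {..<0} \<in> sym_cores t"
  shows "gap t (f ` {..<0}) (r - int s) = gap t (f ` {..<0}) r + int t * int (cnt s t f r) - int s"
proof -
  define B where "B = f ` {..<0}"
  let ?g = "gap t B"
  have Bt: "B \<in> sym_cores t" using assms by (simp add: B_def)
  have Bs: "B \<in> sym_cores s" unfolding B_def using image_sym_cores[OF s f negatives_sym_cores] .
  note gm = gap_mod[OF t Bt] and mg = mem_iff_less_gap[OF t Bt]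
  define y where "y = ?g (r - int s) + int s"
  have yr: "y mod int t = r mod int t"
    unfolding y_def using gm[of "r - int s"] by (metis diff_add_cancel mod_add_cong)
  have "y \<notin> B"
  proof
    assume "y \<in> B"
    then have "y - int s \<in> B" using Bs by (simp add: sym_cores_def down_closed_def)
    then show False using gap_notin[OF t Bt, of "r - int s"] by (simp add: y_def)
  qed
  then have "?g r \<le> y" using mg[of y] gap_cong[OF yr] by simp
  moreover have "int t dvd y - ?g r" using yr gm[of r] by (metis mod_eq_dvd_iff)
  ultimately obtain J where J: "y = ?g r + int t * int J"
  proof -
    from \<open>int t dvd y - ?g r\<close> obtain k where k: "y - ?g r = int t * k" by blast
    then have "0 \<le> int t * k" using \<open>?g r \<le> y\<close> by linarith
    then have "k \<ge> 0" using t by (simp add: zero_le_mult_iff)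
    then show ?thesis using k by (intro that[of "nat k"]) simp
  qed
  have "sset s {..<0} = {0..<int s}" by (auto simp: mem_sset_iff)
  then have S: "f ` {0..<int s} = sset s B" using sset_image[OF f, of "{..<0}"] by (simp add: B_def)
  have "f ` {i \<in> {0..<int s}. f i mod int t = r mod int t} = {y \<in> sset s B. y mod int t = r mod int t}"
    unfolding S[symmetric] by auto
  also have "\<dots> = (\<lambda>j. ?g r + int t * int j) ` {..<J}"
  proof (intro equalityI subsetI)
    fix z assume "z \<in> {y \<in> sset s B. y mod int t = r mod int t}"
    then have z: "z - int s \<in> B" "z \<notin> B" "z mod int t = r mod int t" by (auto simp: mem_sset_iff)
    have "(z - int s) mod int t = (r - int s) mod int t" using z(3) by (metis mod_diff_cong)
    then have "z < y" using z(1) mg[of "z - int s"] gap_cong[of "z - int s" t "r - int s" B] by (simp add: y_def)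
    moreover have "?g r \<le> z" using z(2) mg[of z] gap_cong[OF z(3)] by simp
    moreover have "int t dvd z - ?g r" using z(3) gm[of r] by (metis mod_eq_dvd_iff)
    then obtain k where k: "z = ?g r + int t * k" by (metis dvdE add_diff_cancel_left' diff_add_cancel add.commute)
    ultimately have "0 \<le> int t * k" "int t * k < int t * int J" using J by linarith+
    then have "0 \<le> k" "k < int J" using t by (simp_all add: zero_le_mult_iff)
    then show "z \<in> (\<lambda>j. ?g r + int t * int j) ` {..<J}"
      using k \<open>0 \<le> k\<close> by (intro image_eqI[of _ _ "nat k"]) auto
  next
    fix z assume "z \<in> (\<lambda>j. ?g r + int t * int j) ` {..<J}"
    then obtain j where j: "j < J" "z = ?g r + int t * int j" by auto
    then have zr: "z mod int t = r mod int t" using gm[of r] by simp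
    then have "(z - int s) mod int t = (r - int s) mod int t" by (metis mod_diff_cong)
    then have "?g (z - int s) = ?g (r - int s)" by (rule gap_cong)
    moreover have "int t * int j < int t * int J" using j(1) t by simp
    ultimately have "z - int s \<in> B" using mg[of "z - int s"] j(2) J y_def by simp
    moreover have "0 \<le> int t * int j" by simp
    then have "?g r \<le> z" unfolding j(2) by linarith
    then have "z \<notin> B" using mg[of z] gap_cong[OF zr] by simp
    ultimately show "z \<in> {y \<in> sset s B. y mod int t = r mod int t}" using zr by (simp add: mem_sset_iff)
  qed
  finally have "card (f ` {i \<in> {0..<int s}. f i mod int t = r mod int t}) = card ((\<lambda>j. ?g r + int t * int j) ` {..<J})"
    by simp
  moreover have "inj_on (\<lambda>j. ?g r + int t * int j) {..<J}" using t by (auto intro!: inj_onI)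
  moreover have "inj_on f {i \<in> {0..<int s}. f i mod int t = r mod int t}"
    by (rule inj_on_subset[OF bij_is_inj[OF hypD(1)[OF f]] subset_UNIV])
  ultimately have "cnt s t f r = J" by (simp add: card_image cnt_def)
  then show ?thesis using J by (simp add: y_def B_def)
qed

lemma gap_minus_mult:
  assumes "s \<ge> 1" "t \<ge> 1" "f \<in> aff_hyp s" "f ` {..<0} \<in> sym_cores t"
  shows "gap t (f ` {..<0}) (r - int s * int k) =
    gap t (f ` {..<0}) r + int t * (\<Sum>j<k. int (cnt s t f (r - int s * int j))) - int s * int k"
proof (induction k)
  case (Suc k)
  have "r - int s * int (Suc k) = r - int s * int k - int s" by (simp add: algebra_simps)
  then show ?case
    using gap_minus_s[OF assms, of "r - int s * int k"] Suc by (simp add: algebra_simps)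
qed simp

text \<open>By coprimality, repeated subtraction of \<open>s\<close> reaches every class modulo
  \<open>t\<close>.\<close>

lemma constant_of_shift:
  fixes D :: "int \<Rightarrow> 'a"
  assumes "coprime s t" "t \<ge> 1"
    and cong: "\<And>y z. y mod int t = z mod int t \<Longrightarrow> D y = D z"
    and shift: "\<And>r. D (r - int s) = D r"
  shows "D r = D r'"
proof -
  have "D (r - int s * int k) = D r" for k
  proof (induction k)
    case (Suc k)
    have eq: "r - int s * int (Suc k) = r - int s * int k - int s" by (simp add: algebra_simps)
    show ?case unfolding eq shift by (rule Suc)
  qed simp
  moreover obtain k :: nat where "(r - int s * int k) mod int t = r' mod int t"
    using ex_cong_minus_mult[OF assms(1,2)] by blast
  ultimately show ?thesis using cong by metis
qed

text \<open>The residues fix the class counts, hence the increments of the gap function along the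
  cycle, so the two gap functions differ by a constant. The reflection negates this difference,
  which must then be 0.\<close>

lemma core_unique:
  assumes s: "s \<ge> 1" and t: "t \<ge> 1" and co: "coprime s t" and f: "f \<in> aff_hyp s" and g: "g \<in> aff_hyp s"
    and fB: "f ` {..<0} \<in> sym_cores t" and gB: "g ` {..<0} \<in> sym_cores t"
    and eq: "residues_of s t f = residues_of s t g"
  shows "f ` {..<0} = g ` {..<0}"
proof -
  define D where "D r = gap t (f ` {..<0}) r - gap t (g ` {..<0}) r" for r
  have "cnt s t f = cnt s t g"
    using residues_of_eqD[OF s f g eq] by (simp add: cnt_def cong_def fun_eq_iff)
  then have shift: "D (r - int s) = D r" for r
    by (simp add: D_def gap_minus_s[OF s t f fB] gap_minus_s[OF s t g gB])
  have D_cong: "D y = D z" if "y mod int t = z mod int t" for y z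
    using gap_cong[OF that] by (simp add: D_def)
  have const: "D r = D r'" for r r' by (rule constant_of_shift[OF co t, of D, OF D_cong shift])
  have "D r = 0" for r
    using const[of r "- 1 - r"] gap_minus[OF t fB, of r] gap_minus[OF t gB, of r] unfolding D_def by linarith
  then have "gap t (f ` {..<0}) y = gap t (g ` {..<0}) y" for y by (simp add: D_def)
  then show ?thesis
    using mem_iff_less_gap[OF t fB] mem_iff_less_gap[OF t gB] unfolding set_eq_iff by simp
qed

text \<open>The recursion is solved along the cycle from the class of 0. It closes up after one turn
  because the counts add up to \<open>s\<close>, so the total increment is
  \<open>t * s - s * t = 0\<close>.\<close>

lemma abacus_exists:
  fixes a :: "int \<Rightarrow> nat"
  assumes co: "coprime s t" and t: "t \<ge> 1"
    and cong: "\<And>y z. y mod int t = z mod int t \<Longrightarrow> a y = a z"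
    and sum: "(\<Sum>r\<in>{0..<int t}. a r) = s"
  obtains b :: "int \<Rightarrow> int" where "\<And>r. b r mod int t = r mod int t"
    "\<And>y z. y mod int t = z mod int t \<Longrightarrow> b y = b z"
    "\<And>r. b (r - int s) = b r + int t * int (a r) - int s"
proof -
  have t0: "0 < int t" using t by simp
  have "coprime (int s) (int t)" using co by simp
  then obtain u where u: "[int s * u = 1] (mod int t)" using cong_solve_coprime_int by blast
  \<comment> \<open>As \<open>u\<close> inverts \<open>s\<close> modulo \<open>t\<close>, this is
    the position of the class of \<open>r\<close> on the cycle
    \<open>0, - s, - 2 * s, ...\<close>.\<close>
  define k where "k r = nat ((- r * u) mod int t)" for r
  have k_less: "k r < t" for r unfolding k_def using t0 by (simp add: nat_less_iff)
  have int_k: "int (k r) = (- r * u) mod int t" for r unfolding k_def using t0 by simp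
  have k: "[- (int s * int (k r)) = r] (mod int t)" for r
  proof -
    have "[- int s * ((- r * u) mod int t) = - int s * (- r * u)] (mod int t)"
      by (simp only: cong_def mod_mult_right_eq)
    moreover have "[(int s * u) * r = 1 * r] (mod int t)" using u by (rule cong_scalar_right)
    ultimately show ?thesis unfolding int_k by (simp add: cong_def mult_ac)
  qed
  have k_step: "k (r - int s) = (if k r + 1 = t then 0 else k r + 1)" for r
  proof -
    have "int (k (r - int s)) = (- r * u + int s * u) mod int t" unfolding int_k by (simp add: algebra_simps)
    also have "\<dots> = (int (k r) + 1) mod int t" unfolding int_k using u by (metis cong_def mod_add_cong mod_mod_trivial)
    finally have *: "int (k (r - int s)) = (int (k r) + 1) mod int t" .
    show ?thesis
    proof (cases "k r + 1 = t")
      case True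
      then have "int (k r) + 1 = int t" by linarith
      with * have "int (k (r - int s)) = 0" by (simp only: mod_self)
      then show ?thesis using True by simp
    next
      case False
      then have "int (k r) + 1 < int t" using k_less[of r] by linarith
      then show ?thesis using * False by simp
    qed
  qed
  define b where "b r = int t * (\<Sum>j<k r. int (a (- (int s * int j)))) - int s * int (k r)" for r
  have full: "(\<Sum>j<t. a (- (int s * int j))) = s"
  proof -
    have "inj_on (\<lambda>j. (- (int s * int j)) mod int t) {..<t}"
    proof (rule inj_onI)
      fix i j assume ij: "i \<in> {..<t}" "j \<in> {..<t}" "(- (int s * int i)) mod int t = (- (int s * int j)) mod int t"
      then have "[int s * int i = int s * int j] (mod int t)" 
        by (simp add: cong_def[symmetric] cong_minus_minus_iff)
      then have "[int i = int j] (mod int t)"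
        using co cong_mult_lcancel[of "int s" "int t"] by simp
      then show "i = j" using ij by (simp add: cong_def zmod_int[symmetric])
    qed
    moreover have "(\<lambda>j. (- (int s * int j)) mod int t) ` {..<t} \<subseteq> {0..<int t}" using t0 by auto
    ultimately have "bij_betw (\<lambda>j. (- (int s * int j)) mod int t) {..<t} {0..<int t}"
      by (intro bij_betw_imageI card_subset_eq) (auto simp: card_image)
    then have "(\<Sum>j<t. a ((- (int s * int j)) mod int t)) = (\<Sum>r\<in>{0..<int t}. a r)"
      by (rule sum.reindex_bij_betw)
    moreover have "a (y mod int t) = a y" for y by (rule cong) simp
    ultimately show ?thesis using sum by simp
  qed
  show ?thesis
  proof (rule that[of b])
    show "b r mod int t = r mod int t" for r
    proof -
      have "b r = - (int s * int (k r)) + int t * (\<Sum>j<k r. int (a (- (int s * int j))))"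
        by (simp add: b_def)
      then show ?thesis using k[of r] by (simp only: mod_mult_self2 cong_def)
    qed
    show "b y = b z" if "y mod int t = z mod int t" for y z
    proof -
      have "(- y * u) mod int t = (- z * u) mod int t" using that by (metis mod_minus_cong mod_mult_cong)
      then show ?thesis by (simp add: b_def k_def)
    qed
    show "b (r - int s) = b r + int t * int (a r) - int s" for r
    proof -
      have ak: "a r = a (- (int s * int (k r)))" using k[of r] by (intro cong) (simp add: cong_def)
      have eq: "int t * (\<Sum>j<Suc (k r). int (a (- (int s * int j)))) - int s * int (Suc (k r)) =
          b r + int t * int (a r) - int s"
        by (simp add: b_def ak algebra_simps)
      show ?thesis
      proof (cases "k r + 1 = t")
        case True
        then have "Suc (k r) = t" by simp
        then have "b r + int t * int (a r) - int s = 0"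
          using eq full by (simp add: of_nat_sum[symmetric] del: of_nat_sum)
        then show ?thesis using True k_step[of r] by (simp add: b_def)
      next
        case False
        then show ?thesis using eq k_step[of r] by (simp add: b_def)
      qed
    qed
  qed
qed

text \<open>The reflection of a solution is again a solution, so the two differ by a constant multiple of t;
  the parity assumption makes this multiple even, and half of it is the required correction.\<close>

lemma sym_abacus_exists:
  fixes a :: "int \<Rightarrow> nat"
  assumes co: "coprime s t" and t: "t \<ge> 1"
    and cong: "\<And>y z. y mod int t = z mod int t \<Longrightarrow> a y = a z"
    and sum: "(\<Sum>r\<in>{0..<int t}. a r) = s"
    and sym: "\<And>r. a (int s - 1 - r) = a r"
    and parity: "even t \<Longrightarrow> 2 * p = int s - 1 \<and> odd (a p)"
  obtains b :: "int \<Rightarrow> int" where "\<And>r. b r mod int t = r mod int t"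
    "\<And>y z. y mod int t = z mod int t \<Longrightarrow> b y = b z"
    "\<And>r. b (r - int s) = b r + int t * int (a r) - int s"
    "\<And>r. b (- 1 - r) = int t - 1 - b r"
proof -
  obtain b where b: "\<And>r. b r mod int t = r mod int t"
    "\<And>y z. y mod int t = z mod int t \<Longrightarrow> b y = b z"
    "\<And>r. b (r - int s) = b r + int t * int (a r) - int s"
    using abacus_exists[OF co t cong sum] by blast
  \<comment> \<open>The defect of the reflection symmetry; it is constant, so its value at one
    well-chosen class suffices.\<close>
  define D where "D r = int t - 1 - b (- 1 - r) - b r" for r
  have shift: "D (r - int s) = D r" for r
  proof -
    have "b (- 1 - r) = b (int s - 1 - r) + int t * int (a r) - int s"
      using b(3)[of "int s - 1 - r"] sym[of r] by simp
    then show ?thesis using b(3)[of r] by (simp add: D_def algebra_simps)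
  qed
  have D_cong: "D y = D z" if "y mod int t = z mod int t" for y z
  proof -
    have "(- 1 - y) mod int t = (- 1 - z) mod int t" using that by (metis mod_diff_cong)
    then show ?thesis using b(2)[of "- 1 - y" "- 1 - z"] b(2)[OF that] by (simp add: D_def)
  qed
  have const: "D r = D r'" for r r' by (rule constant_of_shift[OF co t, of D, OF D_cong shift])
  have "\<exists>q e. D q = 2 * int t * e"
  proof (cases "even t")
    case True
    obtain w where w: "b p = p + int t * w" using b(1)[of p, symmetric] by (elim mod_eqE)
    have p: "2 * p = int s - 1" using parity[OF True] by simp
    \<comment> \<open>The middle class \<open>p\<close> and its reflection are neighbours on the
      cycle, so a single step of the recursion computes the defect there.\<close>
    then have "- 1 - p = p - int s" by simp
    then have "b (- 1 - p) = b p + int t * int (a p) - int s" using b(3)[of p] by (simp only:)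
    then have "D p = int t * (1 - int (a p)) - 2 * int t * w"
      using p unfolding D_def w by (simp add: algebra_simps)
    moreover obtain v where "a p = 2 * v + 1" using parity[OF True] by (elim conjE oddE)
    ultimately have "D p = 2 * int t * (- int v - w)" by (simp add: algebra_simps)
    then show ?thesis by blast
  next
    case False
    \<comment> \<open>For odd \<open>t\<close> the class of \<open>(t - 1) / 2\<close> is its own
      reflection.\<close>
    define q where "q = int (t div 2)"
    have q: "2 * q + 1 = int t" using False odd_two_times_div_two_succ[of t] unfolding q_def by linarith
    obtain w where w: "b q = q + int t * w" using b(1)[of q, symmetric] by (elim mod_eqE)
    have "(- 1 - q) mod int t = q mod int t" unfolding mod_eq_dvd_iff q[symmetric] by (intro dvdI[of _ _ "-1"]) simp
    then have "D q = 2 * int t * (- w)" using b(2)[of "- 1 - q" q] w q by (simp add: D_def algebra_simps)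
    then show ?thesis by blast
  qed
  then obtain e where e: "D r = 2 * int t * e" for r using const by metis
  show ?thesis
  proof (rule that[of "\<lambda>r. b r + int t * e"])
    show "b (- 1 - r) + int t * e = int t - 1 - (b r + int t * e)" for r
      using e[of r] unfolding D_def by (simp add: algebra_simps)
    show "b y + int t * e = b z + int t * e" if "y mod int t = z mod int t" for y z
      using b(2)[OF that] by simp
    show "b (r - int s) + int t * e = b r + int t * e + int t * int (a r) - int s" for r
      using b(3)[of r] by simp
  qed (simp add: b(1))
qed

text \<open>A converse to the gap lemmas: any function that behaves like a gap function defines a
  symmetric set. The inequality in \<open>step\<close> is what closure under subtraction of
  \<open>s\<close> requires.\<close>

lemma profile_sym_cores:
  fixes b :: "int \<Rightarrow> int"
  assumes t: "t \<ge> 1" and b_mod: "\<And>r. b r mod int t = r mod int t"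
    and cong: "\<And>y z. y mod int t = z mod int t \<Longrightarrow> b y = b z"
    and step: "\<And>r. b r - int s \<le> b (r - int s)"
    and sym: "\<And>r. b (- 1 - r) = int t - 1 - b r"
  shows "{y. y < b y} \<in> sym_cores s" "{y. y < b y} \<in> sym_cores t"
proof -
  have "bdd_above {y. y < b y}"
  proof (rule bdd_aboveI)
    fix y assume "y \<in> {y. y < b y}"
    then have "y \<le> b (y mod int t)" using cong[of y "y mod int t"] by simp
    also have "\<dots> \<le> \<bar>b (y mod int t)\<bar>" by simp
    also have "\<dots> \<le> (\<Sum>r\<in>{0..<int t}. \<bar>b r\<bar>)" using t by (intro member_le_sum) auto
    finally show "y \<le> (\<Sum>r\<in>{0..<int t}. \<bar>b r\<bar>)" .
  qed
  moreover have "y < b y \<longleftrightarrow> \<not> - 1 - y < b (- 1 - y)" for y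
  proof -
    have "int t dvd b y - y" using b_mod[of y] by (metis mod_eq_dvd_iff)
    then have "y < b y \<longleftrightarrow> y + int t \<le> b y" using zdvd_imp_le[of "int t" "b y - y"] t by auto
    then show ?thesis unfolding sym by linarith
  qed
  ultimately have "sym_beta {y. y < b y}" unfolding sym_beta_def by blast
  moreover have "down_closed s {y. y < b y}"
    unfolding down_closed_def
  proof
    fix y assume "y \<in> {y. y < b y}"
    then show "y - int s \<in> {y. y < b y}" using step[of y] by simp
  qed
  moreover have "down_closed t {y. y < b y}"
  proof -
    have "b (y - int t) = b y" for y by (rule cong) simp
    then show ?thesis by (auto simp: down_closed_def)
  qed
  ultimately show "{y. y < b y} \<in> sym_cores s" "{y. y < b y} \<in> sym_cores t" by (simp_all add: sym_cores_def)
qed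

section \<open>Realising a prescribed residue pattern\<close>

lemma sum_cnt: "t \<ge> 1 \<Longrightarrow> (\<Sum>r\<in>{0..<int t}. cnt s t x r) = s"
proof -
  assume t: "t \<ge> 1"
  have "(\<Sum>r\<in>{0..<int t}. cnt s t x r) = (\<Sum>r\<in>{0..<int t}. \<Sum>i | i \<in> {0..<int s} \<and> x i mod int t = r. 1)"
    by (intro sum.cong) (simp_all add: cnt_def)
  also have "\<dots> = (\<Sum>i\<in>{0..<int s}. 1)" using t by (intro sum.group) auto
  finally show ?thesis by simp
qed

lemma cong_diff_left_iff: "(c - y) mod m = (c - z) mod m \<longleftrightarrow> y mod m = z mod (m :: int)"
  using dvd_diff_commute[of m z y] by (simp add: mod_eq_dvd_iff)

lemma cnt_reflect:
  assumes "\<And>i. i \<in> {0..<int s} \<Longrightarrow> x (int s - 1 - i) mod int t = (int s - 1 - x i) mod int t"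
  shows "cnt s t x (int s - 1 - r) = cnt s t x r"
proof -
  have *: "(int s - 1 - y) mod int t = r mod int t \<longleftrightarrow> y mod int t = (int s - 1 - r) mod int t" for y
    using cong_diff_left_iff[of "int s - 1" y "int t" "int s - 1 - r"] by simp
  have "bij_betw (\<lambda>i. int s - 1 - i) {i \<in> {0..<int s}. x i mod int t = (int s - 1 - r) mod int t}
      {i \<in> {0..<int s}. x i mod int t = r mod int t}"
    by (rule bij_betw_byWitness[of _ "\<lambda>i. int s - 1 - i"]) (auto simp: assms * cong_diff_left_iff)
  then show ?thesis unfolding cnt_def by (rule bij_betw_same_card)
qed

text \<open>The involution \<open>i \<mapsto> s - 1 - i\<close> acts on the counted positions with
  \<open>p\<close> as its only fixed point. This supplies the parity needed for the symmetric abacus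
  when \<open>t\<close> is even.\<close>

lemma odd_cnt_middle:
  assumes x: "\<And>i. i \<in> {0..<int s} \<Longrightarrow> x (int s - 1 - i) mod int t = (int s - 1 - x i) mod int t"
    and p: "2 * p = int s - 1" "x p = p"
  shows "odd (cnt s t x p)"
proof -
  let ?A = "{i \<in> {0..<int s}. x i mod int t = p mod int t}"
  define L where "L = {i \<in> ?A. i < p}"
  define U where "U = {i \<in> ?A. p < i}"
  have sp: "int s - 1 - p = p" using p by simp
  have "x (int s - 1 - i) mod int t = p mod int t" if "i \<in> ?A" for i
  proof -
    have "x (int s - 1 - i) mod int t = (int s - 1 - x i) mod int t" using x that by simp
    also have "\<dots> = (int s - 1 - p) mod int t" using that by (subst cong_diff_left_iff) simp
    finally show ?thesis unfolding sp .
  qed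
  then have "bij_betw (\<lambda>i. int s - 1 - i) L U"
    unfolding L_def U_def using p by (intro bij_betw_byWitness[of _ "\<lambda>i. int s - 1 - i"]) auto
  then have "card L = card U" by (rule bij_betw_same_card)
  moreover have "?A = insert p (L \<union> U)" unfolding L_def U_def using p by auto
  moreover have fin: "finite L" "finite U" unfolding L_def U_def by (rule finite_subset[of _ "{0..<int s}"]; auto)+
  moreover have "card (L \<union> U) = card L + card U" using fin by (intro card_Un_disjoint) (auto simp: L_def U_def)
  moreover have "p \<notin> L \<union> U" by (simp add: L_def U_def)
  ultimately have "card ?A = Suc (2 * card L)" by simp
  then show ?thesis by (simp add: cnt_def)
qed

text \<open>The entries of the pattern in one residue class modulo t are sent, in increasing order, to
  consecutive beads on the corresponding runner; this choice commutes with the reflection.\<close>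

lemma core_exists:
  fixes x :: "int \<Rightarrow> int"
  assumes s: "s \<ge> 1" and t: "t \<ge> 1" and co: "coprime s t"
    and x: "\<And>i. i \<in> {0..<int s} \<Longrightarrow> x (int s - 1 - i) mod int t = (int s - 1 - x i) mod int t"
    and mid: "\<And>p. 2 * p = int s - 1 \<Longrightarrow> x p = p"
  obtains f where "f \<in> aff_hyp s" "f ` {..<0} \<in> sym_cores t" "\<And>i. i \<in> {0..<int s} \<Longrightarrow> f i mod int t = x i mod int t"
proof -
  let ?W = "{0..<int s}"
  define a where "a = cnt s t x"
  have s0: "0 < int s" using s by simp
  have a_cong: "a y = a z" if "y mod int t = z mod int t" for y z using that by (simp add: a_def cnt_def)
  have a_sym: "a (int s - 1 - r) = a r" for r unfolding a_def using cnt_reflect[of s x t, OF x] .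
  have par: "2 * int (s div 2) = int s - 1 \<and> odd (a (int (s div 2)))" if "even t"
  proof -
    have "odd s" using co that coprime_common_divisor[of s t 2] by auto
    then have "2 * int (s div 2) = int s - 1" by presburger
    then show ?thesis using odd_cnt_middle[of s x t, OF x] mid unfolding a_def by blast
  qed
  obtain b where b_mod: "\<And>r. b r mod int t = r mod int t"
    and b_cong: "\<And>y z. y mod int t = z mod int t \<Longrightarrow> b y = b z"
    and b_s: "\<And>r. b (r - int s) = b r + int t * int (a r) - int s"
    and b_sym: "\<And>r. b (- 1 - r) = int t - 1 - b r"
    using sym_abacus_exists[OF co t a_cong _ a_sym par] sum_cnt[OF t, of s x] unfolding a_def by blast
  define B where "B = {y. y < b y}"
  have b_step: "b r - int s \<le> b (r - int s)" for r using b_s[of r] by simp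
  have B: "B \<in> sym_cores s" "B \<in> sym_cores t"
    unfolding B_def by (rule profile_sym_cores[OF t, of b]; (rule b_mod b_step b_sym | erule b_cong))+
  define rk where "rk i = card {j \<in> ?W. j < i \<and> x j mod int t = x i mod int t}" for i
  define h where "h i = b (x i) + int t * int (rk i)" for i
  define f where "f m = h (m mod int s) + int s * (m div int s)" for m
  have f_win: "f i = h i" if "i \<in> ?W" for i using that by (simp add: f_def)
  have h_mod: "h i mod int t = x i mod int t" for i using b_mod[of "x i"] by (simp add: h_def)
  have fin: "finite {j \<in> ?W. P j}" for P by (rule finite_subset[of _ ?W]) auto
  have rk_less: "rk i < a (x i)" if "i \<in> ?W" for i
    unfolding rk_def a_def cnt_def using that
    by (intro psubset_card_mono fin) auto
  have S: "h i \<in> sset s B" if "i \<in> ?W" for i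
  proof -
    have "b (h i) = b (x i)" by (rule b_cong) (rule h_mod)
    moreover have "a (h i) = a (x i)" by (rule a_cong) (rule h_mod)
    moreover have "int t * int (rk i) < int t * int (a (x i))" using rk_less[OF that] t by simp
    moreover have "\<not> int t * int (rk i) < 0" by (simp add: not_less)
    ultimately show ?thesis using b_s[of "h i"] by (simp add: mem_sset_iff B_def h_def)
  qed
  have per: "f (m + int s) = f m + int s" for m using s0 by (simp add: f_def algebra_simps)
  have rk_mono: "rk i < rk j" if "i \<in> ?W" "i < j" "x i mod int t = x j mod int t" for i j
    unfolding rk_def
  proof (rule psubset_card_mono[OF fin psubsetI])
    let ?L = "{k \<in> ?W. k < i \<and> x k mod int t = x i mod int t}" and ?R = "{k \<in> ?W. k < j \<and> x k mod int t = x j mod int t}"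
    show "?L \<subseteq> ?R" using that by auto
    have "i \<in> ?R" "i \<notin> ?L" using that by auto
    then show "?L \<noteq> ?R" by blast
  qed
  have "inj_on f ?W"
  proof (rule inj_onI)
    fix i j assume ij: "i \<in> ?W" "j \<in> ?W" "f i = f j"
    then have hij: "h i = h j" by (simp add: f_win)
    have xij: "x i mod int t = x j mod int t" using h_mod[of i] h_mod[of j] unfolding hij by simp
    have "b (x i) = b (x j)" by (rule b_cong[OF xij])
    then have "rk i = rk j" using hij t by (simp add: h_def)
    with xij show "i = j" using rk_mono[of i j] rk_mono[of j i] ij by (metis less_irrefl linorder_cases)
  qed
  then have win: "bij f" "f ` {..<0} = B" using window_bij[OF s B(1), of f] per S f_win by simp_all
  have refl: "h (int s - 1 - i) = int s - 1 - h i" if i: "i \<in> ?W" for i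
  proof -
    have xi: "x (int s - 1 - i) mod int t = (int s - 1 - x i) mod int t" using x[OF i] .
    have "b (x (int s - 1 - i)) = b (- 1 - (x i - int s))"
    proof (rule b_cong)
      have "- 1 - (x i - int s) = int s - 1 - x i" by simp
      then show "x (int s - 1 - i) mod int t = (- 1 - (x i - int s)) mod int t" using xi by (simp only:)
    qed
    then have b_refl: "b (x (int s - 1 - i)) = int t - 1 - b (x i) - int t * int (a (x i)) + int s"
      using b_sym[of "x i - int s"] b_s[of "x i"] by simp
    let ?U = "{j \<in> ?W. i < j \<and> x j mod int t = x i mod int t}"
    let ?L = "{j \<in> ?W. j < i \<and> x j mod int t = x i mod int t}"
    have xj: "x (int s - 1 - j) mod int t = x (int s - 1 - i) mod int t \<longleftrightarrow> x j mod int t = x i mod int t" if "j \<in> ?W" for j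
      unfolding x[OF that] xi by (rule cong_diff_left_iff)
    have xj': "x j mod int t = x (int s - 1 - i) mod int t \<longleftrightarrow> x (int s - 1 - j) mod int t = x i mod int t" if "j \<in> ?W" for j
      using xj[of "int s - 1 - j"] that by simp
    have "bij_betw (\<lambda>j. int s - 1 - j) {j \<in> ?W. j < int s - 1 - i \<and> x j mod int t = x (int s - 1 - i) mod int t} ?U"
      by (rule bij_betw_byWitness[of _ "\<lambda>j. int s - 1 - j"]) (auto simp: xj xj')
    then have "rk (int s - 1 - i) = card ?U" unfolding rk_def by (rule bij_betw_same_card)
    moreover have "a (x i) = card (insert i (?L \<union> ?U))"
      unfolding a_def cnt_def by (rule arg_cong[of _ _ card]) (use i in auto)
    moreover have "card (insert i (?L \<union> ?U)) = Suc (card ?L + card ?U)"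
    proof -
      have "finite ?L" "finite ?U" by (rule fin)+
      moreover from this have "card (?L \<union> ?U) = card ?L + card ?U" by (intro card_Un_disjoint) auto
      ultimately show ?thesis by (subst card_insert_disjoint) auto
    qed
    \<comment> \<open>The reflection reverses the order within a class, so the ranks
      \<open>0, ..., a - 1\<close> are reversed too; this matches the reversal of the run of beads
      in \<open>b_refl\<close>.\<close>
    ultimately have rk: "int (rk (int s - 1 - i)) = int (a (x i)) - 1 - int (rk i)" unfolding rk_def by simp
    show ?thesis unfolding h_def b_refl rk by (simp add: algebra_simps)
  qed
  have "f (- 1 - m) = - 1 - f m" for m
  proof -
    have m: "(- 1 - m) mod int s = int s - 1 - m mod int s"
      unfolding minus_mult_div_eq_mod[symmetric] div_minus_one_minus[OF s0] by (simp add: algebra_simps)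
    have "m mod int s \<in> ?W" using s0 by simp
    then show ?thesis
      unfolding f_def div_minus_one_minus[OF s0] m by (subst refl) (simp_all add: algebra_simps)
  qed
  then have "f \<in> aff_hyp s" using win(1) per by (simp add: aff_hyp_def)
  then show ?thesis using that win(2) B(2) f_win h_mod by simp
qed

section \<open>Counting by residue patterns\<close>

definition patterns :: "nat \<Rightarrow> nat \<Rightarrow> (int \<Rightarrow> int) set" where
  "patterns s t = {0..<int (s div 2)} \<rightarrow>\<^sub>E {0..<int t}"

text \<open>The second half and the middle are what the reflection forces on a group element with
  the given first half. The symmetry holds exactly, not merely modulo \<open>t\<close>.\<close>

definition unfold_pattern :: "nat \<Rightarrow> (int \<Rightarrow> int) \<Rightarrow> int \<Rightarrow> int" where
  "unfold_pattern s x i =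
    (if i < int (s div 2) then x i else if 2 * i = int s - 1 then i else int s - 1 - x (int s - 1 - i))"

lemma unfold_pattern_reflect:
  "unfold_pattern s x (int s - 1 - i) = int s - 1 - unfold_pattern s x i"
proof -
  have le: "2 * int (s div 2) \<le> int s" by linarith
  consider "i < int (s div 2)" | "2 * i = int s - 1" | "int s - 1 - i < int (s div 2)" by linarith
  then show ?thesis
  proof cases
    case 1
    then have "\<not> int s - 1 - i < int (s div 2)" using le by linarith
    moreover have "int s - 1 < 2 * (int s - 1 - i)" using 1 le zless_imp_add1_zle[OF 1] by (simp add: algebra_simps)
    ultimately show ?thesis using 1 by (simp add: unfold_pattern_def)
  next
    case 2
    then have "\<not> i < int (s div 2)" "int s - 1 - i = i" by linarith+
    then show ?thesis using 2 by (simp add: unfold_pattern_def)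
  next
    case 3
    then have "\<not> i < int (s div 2)" using le by linarith
    moreover have "int s - 1 < 2 * i" using le zless_imp_add1_zle[OF 3] by (simp add: algebra_simps)
    ultimately show ?thesis using 3 by (simp add: unfold_pattern_def)
  qed
qed

lemma sum_unfold_pattern:
  fixes y :: "int \<Rightarrow> nat"
  assumes y: "\<And>v. y (int s - 1 - v) = y v"
  shows "(\<Sum>i\<in>{0..<int s}. y (unfold_pattern s x i)) =
    2 * (\<Sum>i\<in>{0..<int (s div 2)}. y (x i)) + (if odd s then y (int (s div 2)) else 0)"
proof -
  let ?L = "{0..<int (s div 2)}" and ?U = "{int s - int (s div 2)..<int s}"
  let ?M = "if odd s then {int (s div 2)} else {}"
  have W: "{0..<int s} = ?L \<union> ?M \<union> ?U" by (auto split: if_splits; presburger)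
  have "(\<Sum>i\<in>?U. y (unfold_pattern s x i)) = (\<Sum>i\<in>?L. y (unfold_pattern s x (int s - 1 - i)))"
    by (rule sum.reindex_bij_witness[of _ "\<lambda>i. int s - 1 - i" "\<lambda>i. int s - 1 - i"]) auto
  also have "\<dots> = (\<Sum>i\<in>?L. y (x i))"
    unfolding unfold_pattern_reflect y by (rule sum.cong) (simp_all add: unfold_pattern_def)
  finally have U: "(\<Sum>i\<in>?U. y (unfold_pattern s x i)) = (\<Sum>i\<in>?L. y (x i))" .
  have "(\<Sum>i\<in>{0..<int s}. y (unfold_pattern s x i)) =
      (\<Sum>i\<in>?L. y (unfold_pattern s x i)) + (\<Sum>i\<in>?M. y (unfold_pattern s x i)) + (\<Sum>i\<in>?U. y (unfold_pattern s x i))"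
  proof -
    have "2 * int (s div 2) \<le> int s" by linarith
    then have "(?L \<union> ?M) \<inter> ?U = {}" by (auto split: if_splits; presburger)
    moreover have "?L \<inter> ?M = {}" by auto
    ultimately show ?thesis unfolding W by (simp add: sum.union_disjoint)
  qed
  also have "(\<Sum>i\<in>?M. y (unfold_pattern s x i)) = (if odd s then y (int (s div 2)) else 0)"
  proof -
    have "2 * int (s div 2) = int s - 1" if "odd s" using that by presburger
    then show ?thesis by (simp add: unfold_pattern_def)
  qed
  also have "(\<Sum>i\<in>?L. y (unfold_pattern s x i)) = (\<Sum>i\<in>?L. y (x i))"
    by (rule sum.cong) (simp_all add: unfold_pattern_def)
  finally show ?thesis
    unfolding U by simp
qed

text \<open>An arbitrary choice of \<open>f\<close>; by \<open>core_unique\<close> its image of the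
  negatives depends only on the pattern.\<close>

definition core_rep :: "nat \<Rightarrow> nat \<Rightarrow> (int \<Rightarrow> int) \<Rightarrow> int \<Rightarrow> int" where
  "core_rep s t x = (SOME f. f \<in> aff_hyp s \<and> f ` {..<0} \<in> sym_cores t \<and>
    (\<forall>i\<in>{0..<int s}. f i mod int t = unfold_pattern s x i mod int t))"

context
  fixes s t :: nat
  assumes s: "s \<ge> 1" and t: "t \<ge> 1" and co: "coprime s t"
begin

lemma core_rep:
  shows "core_rep s t x \<in> aff_hyp s" "core_rep s t x ` {..<0} \<in> sym_cores t"
    "i \<in> {0..<int s} \<Longrightarrow> core_rep s t x i mod int t = unfold_pattern s x i mod int t"
proof -
  have "unfold_pattern s x p = p" if "2 * p = int s - 1" for p
    using that by (auto simp: unfold_pattern_def)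
  then have "\<exists>f. f \<in> aff_hyp s \<and> f ` {..<0} \<in> sym_cores t \<and>
      (\<forall>i\<in>{0..<int s}. f i mod int t = unfold_pattern s x i mod int t)"
    using core_exists[OF s t co, of "unfold_pattern s x"] unfold_pattern_reflect by metis
  from someI_ex[OF this] show "core_rep s t x \<in> aff_hyp s" "core_rep s t x ` {..<0} \<in> sym_cores t"
    "i \<in> {0..<int s} \<Longrightarrow> core_rep s t x i mod int t = unfold_pattern s x i mod int t"
    unfolding core_rep_def by blast+
qed

lemma residues_of_core_rep:
  assumes "x \<in> patterns s t" shows "residues_of s t (core_rep s t x) = x"
proof
  fix i
  show "residues_of s t (core_rep s t x) i = x i"
  proof (cases "i \<in> {0..<int (s div 2)}")
    case True
    then have "x i \<in> {0..<int t}" using assms unfolding patterns_def by (rule PiE_mem[rotated])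
    moreover have "i \<in> {0..<int s}" using True by auto
    ultimately show ?thesis
      using True core_rep(3)[of i x] by (simp add: residues_of_def unfold_pattern_def)
  next
    case False
    then show ?thesis
      using PiE_arb[OF assms[unfolded patterns_def] False] by (simp only: residues_of_def restrict_apply if_False)
  qed
qed

lemma residues_of_in_patterns: "residues_of s t f \<in> patterns s t"
  using t by (auto simp: residues_of_def patterns_def)

lemma finite_patterns: "finite (patterns s t)"
  by (simp add: patterns_def finite_PiE)

lemma card_pos_stab:
  assumes "f \<in> aff_hyp s"
  shows "finite (stab s t (f ` {..<0}))" "card (stab s t (f ` {..<0})) > 0"
    "card {g \<in> aff_hyp s. g ` {..<0} = f ` {..<0} \<and> residues_of s t g = residues_of s t f} = card (stab s t (f ` {..<0}))"
proof -
  let ?F = "{g \<in> aff_hyp s. g ` {..<0} = f ` {..<0} \<and> residues_of s t g = residues_of s t f}"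
  have "finite {g \<in> aff_hyp s. g ` {..<0} = f ` {..<0}}"
    using finite_fibre(1)[OF s image_sym_cores[OF s assms negatives_sym_cores]] .
  then have fin: "finite ?F" by (rule rev_finite_subset) auto
  note bij = bij_betw_stab[OF s assms, of t]
  show "finite (stab s t (f ` {..<0}))" using bij_betw_finite[OF bij] fin by simp
  moreover have "id \<in> stab s t (f ` {..<0})" by (simp add: stab_def id_hyp)
  ultimately show "card (stab s t (f ` {..<0})) > 0" by (auto simp: card_gt_0_iff)
  show "card ?F = card (stab s t (f ` {..<0}))" using bij_betw_same_card[OF bij] by simp
qed

text \<open>Both sides sum over all f whose image of the negatives is a t-core: on the left these are
  grouped by this image, on the right by their residue pattern.\<close>

lemma sum_cores_eq_sum_patterns:
  fixes G :: "int set \<Rightarrow> real"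
  shows "real (card {g \<in> aff_hyp s. g ` {..<0} = {..<0}}) *
      (\<Sum>B\<in>sym_cores s \<inter> sym_cores t. inverse (real (card (stab s t B))) * G B) =
    (\<Sum>x\<in>patterns s t. G (core_rep s t x ` {..<0}))"
proof -
  define C where "C = {f \<in> aff_hyp s. f ` {..<0} \<in> sym_cores t}"
  define w where "w B = inverse (real (card (stab s t B))) * G B" for B
  \<comment> \<open>By uniqueness all \<open>f\<close> with the pattern \<open>x\<close> share one
    image, so they form a single orbit of its stabilizer, whose size cancels the weight.\<close>
  have fib: "{f \<in> C. residues_of s t f = x} = {g \<in> aff_hyp s. g ` {..<0} = core_rep s t x ` {..<0} \<and>
      residues_of s t g = residues_of s t (core_rep s t x)}" if "x \<in> patterns s t" for x
  proof -
    have eq: "f ` {..<0} = core_rep s t x ` {..<0}" if "f \<in> C" "residues_of s t f = x" for f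
      using core_unique[OF s t co _ core_rep(1) _ core_rep(2), of f x] that
        residues_of_core_rep[OF \<open>x \<in> patterns s t\<close>] by (simp add: C_def)
    show ?thesis
    proof (intro Set.set_eqI iffI)
      fix f
      show "f \<in> {g \<in> aff_hyp s. g ` {..<0} = core_rep s t x ` {..<0} \<and> residues_of s t g = residues_of s t (core_rep s t x)}"
        if "f \<in> {f \<in> C. residues_of s t f = x}"
        using eq[of f] that residues_of_core_rep[OF \<open>x \<in> patterns s t\<close>] by (simp add: C_def)
      show "f \<in> {f \<in> C. residues_of s t f = x}"
        if "f \<in> {g \<in> aff_hyp s. g ` {..<0} = core_rep s t x ` {..<0} \<and> residues_of s t g = residues_of s t (core_rep s t x)}"
        using that core_rep(2)[of x] residues_of_core_rep[OF \<open>x \<in> patterns s t\<close>] by (simp add: C_def)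
    qed
  qed
  have card_fib: "card {f \<in> C. residues_of s t f = x} = card (stab s t (core_rep s t x ` {..<0}))"
    if "x \<in> patterns s t" for x
    unfolding fib[OF that] by (rule card_pos_stab(3)[OF core_rep(1)])
  have fin: "finite C"
  proof (rule finite_subset)
    show "C \<subseteq> (\<Union>x\<in>patterns s t. {f \<in> C. residues_of s t f = x})" using residues_of_in_patterns by auto
    show "finite (\<Union>x\<in>patterns s t. {f \<in> C. residues_of s t f = x})"
    proof (rule finite_UN_I[OF finite_patterns])
      fix x assume x: "x \<in> patterns s t"
      show "finite {f \<in> C. residues_of s t f = x}"
        using card_fib[OF x] card_pos_stab(2)[OF core_rep(1)[of x]] by (intro card_ge_0_finite) simp
    qed
  qed
  have img: "sym_cores s \<inter> sym_cores t = (\<lambda>f. f ` {..<0}) ` C"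
  proof
    show "sym_cores s \<inter> sym_cores t \<subseteq> (\<lambda>f. f ` {..<0}) ` C"
    proof
      fix B assume B: "B \<in> sym_cores s \<inter> sym_cores t"
      then obtain f where "f \<in> aff_hyp s" "f ` {..<0} = B" using hyp_transitive[OF s] by blast
      then show "B \<in> (\<lambda>f. f ` {..<0}) ` C" using B by (intro image_eqI[of _ _ f]) (auto simp: C_def)
    qed
    show "(\<lambda>f. f ` {..<0}) ` C \<subseteq> sym_cores s \<inter> sym_cores t"
      using image_sym_cores[OF s _ negatives_sym_cores] by (auto simp: C_def)
  qed
  have "(\<Sum>f\<in>C. w (f ` {..<0})) = (\<Sum>x\<in>patterns s t. \<Sum>f | f \<in> C \<and> residues_of s t f = x. w (f ` {..<0}))"
    using fin residues_of_in_patterns by (intro sum.group[symmetric] finite_patterns) auto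
  also have "\<dots> = (\<Sum>x\<in>patterns s t. G (core_rep s t x ` {..<0}))"
  proof (rule sum.cong[OF refl])
    fix x assume x: "x \<in> patterns s t"
    have "(\<Sum>f | f \<in> C \<and> residues_of s t f = x. w (f ` {..<0})) =
        (\<Sum>f | f \<in> C \<and> residues_of s t f = x. w (core_rep s t x ` {..<0}))"
    proof (rule sum.cong[OF refl])
      fix f assume "f \<in> {f. f \<in> C \<and> residues_of s t f = x}"
      then have "f ` {..<0} = core_rep s t x ` {..<0}" using fib[OF x] by blast
      then show "w (f ` {..<0}) = w (core_rep s t x ` {..<0})" by simp
    qed
    also have "\<dots> = real (card (stab s t (core_rep s t x ` {..<0}))) * w (core_rep s t x ` {..<0})"
      using card_fib[OF x] by simp
    also have "\<dots> = G (core_rep s t x ` {..<0})"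
      using card_pos_stab(2)[OF core_rep(1)[of x]] unfolding w_def by simp
    finally show "(\<Sum>f | f \<in> C \<and> residues_of s t f = x. w (f ` {..<0})) = G (core_rep s t x ` {..<0})" .
  qed
  finally have 1: "(\<Sum>f\<in>C. w (f ` {..<0})) = (\<Sum>x\<in>patterns s t. G (core_rep s t x ` {..<0}))" .
  have "(\<Sum>f\<in>C. w (f ` {..<0})) = (\<Sum>B\<in>sym_cores s \<inter> sym_cores t. \<Sum>f | f \<in> C \<and> f ` {..<0} = B. w (f ` {..<0}))"
    using fin unfolding img by (intro sum.group[symmetric]) auto
  also have "\<dots> = (\<Sum>B\<in>sym_cores s \<inter> sym_cores t. real (card {g \<in> aff_hyp s. g ` {..<0} = {..<0}}) * w B)"
  proof (rule sum.cong[OF refl])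
    fix B assume B: "B \<in> sym_cores s \<inter> sym_cores t"
    then have "{f. f \<in> C \<and> f ` {..<0} = B} = {g \<in> aff_hyp s. g ` {..<0} = B}" by (auto simp: C_def)
    moreover have "card {g \<in> aff_hyp s. g ` {..<0} = B} = card {g \<in> aff_hyp s. g ` {..<0} = {..<0}}"
      using finite_fibre(2)[OF s] B by blast
    ultimately show "(\<Sum>f | f \<in> C \<and> f ` {..<0} = B. w (f ` {..<0})) = real (card {g \<in> aff_hyp s. g ` {..<0} = {..<0}}) * w B"
      by simp
  qed
  finally show ?thesis using 1 by (simp add: sum_distrib_left w_def)
qed

end

section \<open>Second moments\<close>

text \<open>Second moment of a constant plus independent centred summands: the cross terms vanish.
  The induction splits off one coordinate and absorbs its value into the constant \<open>d\<close>,
  which is why \<open>d\<close> is generalised.\<close>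

lemma sum_PiE_square:
  fixes g :: "'b \<Rightarrow> real" and d :: real
  assumes "finite I" "finite Y" "(\<Sum>v\<in>Y. g v) = 0" "card Y > 0"
  shows "(\<Sum>x\<in>I \<rightarrow>\<^sub>E Y. (d + 2 * (\<Sum>i\<in>I. g (x i)))\<^sup>2) =
    real (card Y) ^ card I * (d\<^sup>2 + 4 * real (card I) * (\<Sum>v\<in>Y. (g v)\<^sup>2) / real (card Y))"
  using assms(1)
proof (induction I arbitrary: d rule: finite_induct)
  case empty
  then show ?case by simp
next
  case (insert i I)
  let ?c = "4 * real (card I) * (\<Sum>v\<in>Y. (g v)\<^sup>2) / real (card Y)"
  have inj: "inj_on (\<lambda>(y, x). x(i := y)) (Y \<times> (I \<rightarrow>\<^sub>E Y))"
    using inj_combinator[OF insert(2), of "\<lambda>_. Y"] by simp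
  have step: "(\<Sum>j\<in>insert i I. g ((x(i := y)) j)) = g y + (\<Sum>j\<in>I. g (x j))" for x y
  proof -
    have "(\<Sum>j\<in>I. g ((x(i := y)) j)) = (\<Sum>j\<in>I. g (x j))" using insert(2) by (intro sum.cong) auto
    then show ?thesis using insert(1,2) by simp
  qed
  have "(\<Sum>x\<in>insert i I \<rightarrow>\<^sub>E Y. (d + 2 * (\<Sum>j\<in>insert i I. g (x j)))\<^sup>2) =
      (\<Sum>(y, x)\<in>Y \<times> (I \<rightarrow>\<^sub>E Y). (d + 2 * (g y + (\<Sum>j\<in>I. g (x j))))\<^sup>2)"
    unfolding PiE_insert_eq by (subst sum.reindex[OF inj]) (simp only: o_def case_prod_unfold step)
  also have "\<dots> = (\<Sum>y\<in>Y. \<Sum>x\<in>I \<rightarrow>\<^sub>E Y. ((d + 2 * g y) + 2 * (\<Sum>j\<in>I. g (x j)))\<^sup>2)"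
    by (simp add: sum.cartesian_product algebra_simps)
  also have "\<dots> = (\<Sum>y\<in>Y. real (card Y) ^ card I * ((d + 2 * g y)\<^sup>2 + ?c))"
    by (simp only: insert.IH)
  also have "\<dots> = real (card Y) ^ card I * (\<Sum>y\<in>Y. d\<^sup>2 + 4 * d * g y + 4 * (g y)\<^sup>2 + ?c)"
    by (simp add: sum_distrib_left power2_eq_square algebra_simps)
  also have "(\<Sum>y\<in>Y. d\<^sup>2 + 4 * d * g y + 4 * (g y)\<^sup>2 + ?c) =
      real (card Y) * d\<^sup>2 + 4 * d * (\<Sum>y\<in>Y. g y) + 4 * (\<Sum>y\<in>Y. (g y)\<^sup>2) + real (card Y) * ?c"
    by (simp only: sum.distrib sum_distrib_left[symmetric] sum_constant)
  also have "\<dots> = real (card Y) * (d\<^sup>2 + 4 * real (card (insert i I)) * (\<Sum>v\<in>Y. (g v)\<^sup>2) / real (card Y))"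
    using assms(3,4) insert(1,2) by (simp add: field_simps)
  finally show ?case using insert(1,2) by simp
qed

text \<open>For \<open>k \<le> t\<close> the classes \<open>r, r - s, ...\<close> are distinct and
  this is the indicator of an arc of \<open>k\<close> classes; written as a count, it is additive in
  the steps of the arc.\<close>

definition hits :: "nat \<Rightarrow> nat \<Rightarrow> int \<Rightarrow> nat \<Rightarrow> int \<Rightarrow> nat" where
  "hits s t r k v = card {j \<in> {..<k}. v mod int t = (r - int s * int j) mod int t}"

lemma sum_cnt_arc:
  "(\<Sum>j<k. cnt s t x (r - int s * int j)) = (\<Sum>i\<in>{0..<int s}. hits s t r k (x i))"
proof -
  have "cnt s t x (r - int s * int j) = (\<Sum>i\<in>{0..<int s}. of_bool (x i mod int t = (r - int s * int j) mod int t))" for j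
    by (simp add: cnt_def sum_of_bool_eq Int_def)
  moreover have "hits s t r k v = (\<Sum>j<k. of_bool (v mod int t = (r - int s * int j) mod int t))" for v
    by (simp add: hits_def sum_of_bool_eq Int_def)
  ultimately show ?thesis by (simp only:) (rule sum.swap)
qed

lemma hits_cong: "v mod int t = w mod int t \<Longrightarrow> hits s t r k v = hits s t r k w"
  by (simp add: hits_def)

text \<open>With the arc ending just before the class of \<open>- 1 - r\<close>, the map
  \<open>v \<mapsto> s - 1 - v\<close> sends its \<open>j\<close>-th class to its
  \<open>(k - 1 - j)\<close>-th, so the arc is symmetric.\<close>

lemma hits_reflect:
  assumes "(r - int s * int k) mod int t = (- 1 - r) mod int t"
  shows "hits s t r k (int s - 1 - v) = hits s t r k v"
proof -
  have *: "(int s - 1 - v) mod int t = (r - int s * int j) mod int t \<longleftrightarrow>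
      v mod int t = (r - int s * int (k - 1 - j)) mod int t" if "j < k" for j
  proof -
    have "int t dvd (r - int s * int k) - (- 1 - r)" using assms by (metis mod_eq_dvd_iff)
    then have "int t dvd (int s - 1 - v) - (r - int s * int j) \<longleftrightarrow>
        int t dvd ((int s - 1 - v) - (r - int s * int j)) + ((r - int s * int k) - (- 1 - r))"
      by (rule dvd_add_left_iff[symmetric])
    also have "((int s - 1 - v) - (r - int s * int j)) + ((r - int s * int k) - (- 1 - r)) =
        (r - int s * int (k - 1 - j)) - v"
      using that by (simp add: of_nat_diff algebra_simps)
    finally show ?thesis unfolding mod_eq_dvd_iff by (simp add: dvd_diff_commute)
  qed
  have "bij_betw (\<lambda>j. k - 1 - j) {j \<in> {..<k}. (int s - 1 - v) mod int t = (r - int s * int j) mod int t}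
      {j \<in> {..<k}. v mod int t = (r - int s * int j) mod int t}"
  proof (rule bij_betw_byWitness[of _ "\<lambda>j. k - 1 - j"])
    show "(\<lambda>j. k - 1 - j) ` {j \<in> {..<k}. (int s - 1 - v) mod int t = (r - int s * int j) mod int t}
      \<subseteq> {j \<in> {..<k}. v mod int t = (r - int s * int j) mod int t}"
    proof (rule image_subsetI)
      fix j assume "j \<in> {j \<in> {..<k}. (int s - 1 - v) mod int t = (r - int s * int j) mod int t}"
      then show "k - 1 - j \<in> {j \<in> {..<k}. v mod int t = (r - int s * int j) mod int t}"
        using *[of j] unfolding mem_Collect_eq by auto
    qed
    show "(\<lambda>j. k - 1 - j) ` {j \<in> {..<k}. v mod int t = (r - int s * int j) mod int t}
      \<subseteq> {j \<in> {..<k}. (int s - 1 - v) mod int t = (r - int s * int j) mod int t}"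
    proof (rule image_subsetI)
      fix j assume j: "j \<in> {j \<in> {..<k}. v mod int t = (r - int s * int j) mod int t}"
      then have "k - 1 - (k - 1 - j) = j" "k - 1 - j < k" by auto
      then show "k - 1 - j \<in> {j \<in> {..<k}. (int s - 1 - v) mod int t = (r - int s * int j) mod int t}"
        using *[of "k - 1 - j"] j unfolding mem_Collect_eq by (simp only: lessThan_iff)
    qed
  qed auto
  then show ?thesis unfolding hits_def by (rule bij_betw_same_card)
qed

context
  fixes s t :: nat
  assumes t: "t \<ge> 1" and co: "coprime s t"
begin

lemma hits_le_1:
  assumes "k \<le> t" shows "hits s t r k v \<le> 1"
proof -
  have "i = j" if "i < k" "j < k" "v mod int t = (r - int s * int i) mod int t"
    "v mod int t = (r - int s * int j) mod int t" for i j
  proof -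
    have "[r - int s * int i = r - int s * int j] (mod int t)" using that by (simp add: cong_def)
    then have "[r - (r - int s * int i) = r - (r - int s * int j)] (mod int t)" by (rule cong_diff[OF cong_refl])
    then have "[int s * int i = int s * int j] (mod int t)" by simp
    then have "[int i = int j] (mod int t)" using co cong_mult_lcancel[of "int s" "int t"] by simp
    then show ?thesis using that assms by (simp add: cong_def zmod_int[symmetric])
  qed
  then show ?thesis unfolding hits_def by (intro card_le_Suc0_iff_eq[THEN iffD2, folded One_nat_def]) auto
qed

lemma sum_hits: "(\<Sum>v\<in>{0..<int t}. hits s t r k v) = k"
proof -
  have "(\<Sum>v\<in>{0..<int t}. hits s t r k v) =
      (\<Sum>v\<in>{0..<int t}. \<Sum>j | j \<in> {..<k} \<and> (r - int s * int j) mod int t = v. 1)"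
    by (intro sum.cong refl) (auto simp: hits_def intro!: arg_cong[of _ _ card])
  also have "\<dots> = (\<Sum>j\<in>{..<k}. 1)" using t by (intro sum.group) auto
  finally show ?thesis by simp
qed

text \<open>The indicator of \<open>k\<close> out of \<open>t\<close> classes, scaled by
  \<open>t\<close> and centred, takes the value \<open>t - k\<close> on \<open>k\<close> classes and
  \<open>- k\<close> on the remaining \<open>t - k\<close>.\<close>

lemma sum_hits_centred:
  assumes "k \<le> t"
  shows "(\<Sum>v\<in>{0..<int t}. real t * real (hits s t r k v) - real k) = 0"
    "(\<Sum>v\<in>{0..<int t}. (real t * real (hits s t r k v) - real k)\<^sup>2) = real t * (real k * (real t - real k))"
proof -
  have sum: "(\<Sum>v\<in>{0..<int t}. real (hits s t r k v)) = real k"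
    using sum_hits[of r k] by (simp flip: of_nat_sum)
  then show "(\<Sum>v\<in>{0..<int t}. real t * real (hits s t r k v) - real k) = 0"
    by (simp add: sum_subtractf sum_distrib_left[symmetric])
  have sq: "(real t * real (hits s t r k v) - real k)\<^sup>2 =
      (real t)\<^sup>2 * real (hits s t r k v) - 2 * real t * real k * real (hits s t r k v) + (real k)\<^sup>2" for v
  proof -
    have "hits s t r k v = 0 \<or> hits s t r k v = 1" using hits_le_1[OF assms, of r v] by linarith
    then show ?thesis by (auto simp: power2_eq_square algebra_simps)
  qed
  show "(\<Sum>v\<in>{0..<int t}. (real t * real (hits s t r k v) - real k)\<^sup>2) = real t * (real k * (real t - real k))"
    unfolding sq sum.distrib sum_subtractf sum_distrib_left[symmetric] sum
    by (simp add: power2_eq_square algebra_simps)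
qed

end

section \<open>The average size\<close>

text \<open>The arc r, r - s, ... of this length stops just before the class of - 1 - r, which carries the
  reflection of the gap at r. The bias is, up to sign, the mean of the shifted gap.\<close>

definition arc_length :: "nat \<Rightarrow> nat \<Rightarrow> int \<Rightarrow> nat" where
  "arc_length s t r = (SOME k. k < t \<and> (r - int s * int k) mod int t = (- 1 - r) mod int t)"

definition arc_bias :: "nat \<Rightarrow> nat \<Rightarrow> int \<Rightarrow> int" where
  "arc_bias s t r =
    int t * (if odd s then int (hits s t r (arc_length s t r) (int (s div 2))) else 0)
    + 2 * int (s div 2) * int (arc_length s t r) - int s * int (arc_length s t r)"

lemma sum_int_interval: "(\<Sum>j\<in>{0..<int n}. f j) = (\<Sum>j<n. f (int j))"
  by (rule sum.reindex_bij_witness[of _ int nat]) auto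

lemma sum_abs_odd_steps:
  "2 * (\<Sum>j<t. \<bar>int t - 1 - 2 * int j\<bar>) = (if odd t then (int t)\<^sup>2 - 1 else (int t)\<^sup>2)"
proof (induction t rule: induct_nat_012)
  case (ge2 t)
  have "(\<Sum>j<Suc (Suc t). \<bar>int (Suc (Suc t)) - 1 - 2 * int j\<bar>) = 2 * (int t + 1) + (\<Sum>j<t. \<bar>int t - 1 - 2 * int j\<bar>)"
    unfolding sum.lessThan_Suc_shift[of _ "Suc t"] by (simp add: algebra_simps)
  then show ?case using ge2(1) by (simp add: power2_eq_square algebra_simps)
qed simp_all

lemma sum_square_odd_steps: "3 * (\<Sum>j<t. (int t - 1 - 2 * int j)\<^sup>2) = int t * ((int t)\<^sup>2 - 1)"
proof -
  have "(int t - 1 - 2 * j)\<^sup>2 = (int t - 1)\<^sup>2 - 4 * (int t - 1) * j + 4 * j\<^sup>2" for j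
    by (simp add: power2_eq_square algebra_simps)
  then have "3 * (\<Sum>j\<in>{0..<int t}. (int t - 1 - 2 * j)\<^sup>2) =
      3 * (int t * (int t - 1)\<^sup>2) - 6 * (int t - 1) * (2 * (\<Sum>j\<in>{0..<int t}. j)) + 2 * (6 * (\<Sum>j\<in>{0..<int t}. j\<^sup>2))"
    by (simp add: sum.distrib sum_subtractf sum_distrib_left[symmetric])
  also have "\<dots> = int t * ((int t)\<^sup>2 - 1)"
    unfolding sum_int_atLeastLessThan by (simp add: power2_eq_square algebra_simps)
  finally show ?thesis by (simp add: sum_int_interval)
qed

lemma sum_mult_complement: "6 * (\<Sum>k<t. int k * (int t - int k)) = int t * ((int t)\<^sup>2 - 1)"
proof -
  have "6 * (\<Sum>k\<in>{0..<int t}. k * (int t - k)) = 3 * int t * (2 * (\<Sum>k\<in>{0..<int t}. k)) - 6 * (\<Sum>k\<in>{0..<int t}. k\<^sup>2)"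
    by (simp add: right_diff_distrib sum_subtractf sum_distrib_left power2_eq_square mult_ac)
  also have "\<dots> = int t * ((int t)\<^sup>2 - 1)"
    unfolding sum_int_atLeastLessThan by (simp add: power2_eq_square algebra_simps)
  finally show ?thesis by (simp add: sum_int_interval)
qed

context
  fixes s t :: nat
  assumes s: "s \<ge> 1" and t: "t \<ge> 1" and co: "coprime s t"
begin

lemma arc_length: "arc_length s t r < t"
    "(r - int s * int (arc_length s t r)) mod int t = (- 1 - r) mod int t"
proof -
  obtain k where "k < t" "(r - int s * int k) mod int t = (- 1 - r) mod int t"
    using ex_cong_minus_mult[OF co t, of r "- 1 - r"] by blast
  then have "\<exists>k. k < t \<and> (r - int s * int k) mod int t = (- 1 - r) mod int t" by blast
  from someI_ex[OF this] show "arc_length s t r < t"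
    "(r - int s * int (arc_length s t r)) mod int t = (- 1 - r) mod int t"
    unfolding arc_length_def by blast+
qed

text \<open>The walk of \<open>arc_length\<close> steps from \<open>r\<close> ends at the class of
  \<open>- 1 - r\<close>, whose gap is \<open>t - 1\<close> minus the gap at \<open>r\<close>; this
  leaves one linear equation for the latter. The mirrored residues double the sum over the first
  half, and each summand is centred by its mean.\<close>

lemma gap_core_rep:
  "2 * gap t (core_rep s t x ` {..<0}) r - (int t - 1) =
    - (arc_bias s t r + 2 * (\<Sum>i\<in>{0..<int (s div 2)}. int t * int (hits s t r (arc_length s t r) (x i)) - int (arc_length s t r)))"
proof -
  define f where "f = core_rep s t x"
  define b where "b = gap t (f ` {..<0})"
  define k where "k = arc_length s t r"
  note f = core_rep(1,2)[OF s t co, of x, folded f_def]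
  have "b (r - int s * int k) = b (- 1 - r)"
    unfolding b_def k_def using arc_length(2) by (rule gap_cong)
  also have "\<dots> = int t - 1 - b r" unfolding b_def by (rule gap_minus[OF t f(2)])
  finally have "int t - 1 - b r = b r + int t * (\<Sum>j<k. int (cnt s t f (r - int s * int j))) - int s * int k"
    using gap_minus_mult[OF s t f, of r k] by (simp add: b_def)
  moreover have "(\<Sum>j<k. cnt s t f (r - int s * int j)) = (\<Sum>i\<in>{0..<int s}. hits s t r k (unfold_pattern s x i))"
    unfolding sum_cnt_arc f_def by (intro sum.cong refl hits_cong core_rep(3)[OF s t co])
  moreover have "hits s t r k (int s - 1 - v) = hits s t r k v" for v
    unfolding k_def by (rule hits_reflect[OF arc_length(2)])
  ultimately have "2 * b r - (int t - 1) = int s * int k - int t * (2 * (\<Sum>i\<in>{0..<int (s div 2)}. int (hits s t r k (x i)))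
      + (if odd s then int (hits s t r k (int (s div 2))) else 0))"
    using sum_unfold_pattern[of "hits s t r k" s x] by (simp flip: of_nat_sum split: if_splits)
  then show ?thesis
    unfolding arc_bias_def k_def[symmetric] b_def f_def
    by (simp add: sum_subtractf sum_distrib_left[symmetric] algebra_simps)
qed

lemma sum_square_gap_core_rep:
  "(\<Sum>x\<in>patterns s t. (real_of_int (2 * gap t (core_rep s t x ` {..<0}) r - (int t - 1)))\<^sup>2) =
    real t ^ (s div 2) * real_of_int ((arc_bias s t r)\<^sup>2
      + 4 * int (s div 2) * (int (arc_length s t r) * (int t - int (arc_length s t r))))"
proof -
  define k where "k = arc_length s t r"
  let ?g = "\<lambda>v. real t * real (hits s t r k v) - real k"
  have k: "k \<le> t" using arc_length(1) by (simp add: k_def less_imp_le)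
  have "(\<Sum>x\<in>patterns s t. (real_of_int (2 * gap t (core_rep s t x ` {..<0}) r - (int t - 1)))\<^sup>2) =
      (\<Sum>x\<in>patterns s t. (real_of_int (arc_bias s t r) + 2 * (\<Sum>i\<in>{0..<int (s div 2)}. ?g (x i)))\<^sup>2)"
    unfolding gap_core_rep k_def by (simp only: of_int_minus power2_minus) simp
  also have "\<dots> = real t ^ (s div 2) * ((real_of_int (arc_bias s t r))\<^sup>2 + 4 * real (s div 2) * (\<Sum>v\<in>{0..<int t}. (?g v)\<^sup>2) / real t)"
    unfolding patterns_def using sum_PiE_square[of "{0..<int (s div 2)}" "{0..<int t}" ?g] sum_hits_centred(1)[OF t co k] t by simp
  also have "\<dots> = real t ^ (s div 2) * ((real_of_int (arc_bias s t r))\<^sup>2 + 4 * real (s div 2) * (real k * (real t - real k)))"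
    using sum_hits_centred(2)[OF t co k] t by simp
  finally show ?thesis by (simp add: k_def)
qed

text \<open>For odd s the biases have the parity of t - 1, lie strictly between - t and t, and determine r.\<close>

lemma sum_arc_bias:
  fixes P :: "int \<Rightarrow> int"
  assumes "odd s"
  shows "(\<Sum>r\<in>{0..<int t}. P (arc_bias s t r)) = (\<Sum>j<t. P (int t - 1 - 2 * int j))"
    "int (arc_length s t r) * (int t - int (arc_length s t r)) = \<bar>arc_bias s t r\<bar> * (int t - \<bar>arc_bias s t r\<bar>)"
proof -
  define k where "k r = arc_length s t r" for r
  define e where "e r = hits s t r (k r) (int (s div 2))" for r
  have k: "k r < t" for r using arc_length(1) by (simp add: k_def)
  have "e r \<le> 1" for r unfolding e_def by (rule hits_le_1[OF t co less_imp_le[OF k]])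
  moreover have "e r = 0" if "k r = 0" for r using that by (simp add: e_def hits_def)
  ultimately have e: "e r = 0 \<or> e r = 1 \<and> k r \<ge> 1" for r by (metis One_nat_def Suc_leI le_Suc_eq le_zero_eq not_gr_zero)
  have n: "2 * int (s div 2) = int s - 1" using assms by presburger
  have bias: "arc_bias s t r = int t * int (e r) - int (k r)" for r
  proof -
    have "arc_bias s t r = int t * int (e r) + (2 * int (s div 2)) * int (k r) - int s * int (k r)"
      using assms by (simp add: arc_bias_def e_def k_def)
    then show ?thesis unfolding n by (simp add: algebra_simps)
  qed
  \<comment> \<open>The bias is \<open>- k\<close> or \<open>t - k\<close>, and
    \<open>k * (t - k)\<close> is unchanged when \<open>k\<close> is replaced by
    \<open>t - k\<close>.\<close>
  show "int (arc_length s t r) * (int t - int (arc_length s t r)) = \<bar>arc_bias s t r\<bar> * (int t - \<bar>arc_bias s t r\<bar>)"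
    unfolding bias k_def[symmetric] using e[of r] k[of r] by auto
  \<comment> \<open>An auxiliary core, here for the pattern 0: it expresses the bias through an
    actual gap, which gives its parity and, as the gap at \<open>r\<close> is congruent to
    \<open>r\<close>, its injectivity.\<close>
  define b where "b = gap t (core_rep s t (\<lambda>_. 0) ` {..<0})"
  define S where "S r = (\<Sum>i\<in>{0..<int (s div 2)}. int (hits s t r (k r) 0))" for r
  define j where "j r = b r - int (s div 2) * int (k r) + int t * S r" for r
  have j: "int t - 1 - arc_bias s t r = 2 * j r" for r
    using gap_core_rep[of "\<lambda>_. 0" r] unfolding j_def S_def b_def k_def
    by (simp add: sum_subtractf sum_distrib_left[symmetric] algebra_simps)
  have range: "j r \<in> {0..<int t}" for r
    using j[of r] e[of r] k[of r] unfolding bias by auto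
  have inj: "inj_on j {0..<int t}"
  proof (rule inj_onI)
    fix r r' assume r: "r \<in> {0..<int t}" "r' \<in> {0..<int t}" "j r = j r'"
    have "arc_bias s t r = arc_bias s t r'" using j[of r] j[of r'] r(3) by simp
    then have kk: "k r = k r'" using e[of r] e[of r'] k[of r] k[of r'] unfolding bias by auto
    have "b r = b r' + int t * (S r' - S r)"
      using r(3) unfolding j_def kk by (simp add: algebra_simps)
    then have "b r mod int t = b r' mod int t" by simp
    then have "r mod int t = r' mod int t"
      unfolding b_def using gap_mod[OF t core_rep(2)[OF s t co]] by simp
    then show "r = r'" using r by simp
  qed
  have "j ` {0..<int t} = {0..<int t}" using range inj by (intro endo_inj_surj) auto
  then have "bij_betw j {0..<int t} {0..<int t}" using inj by (simp add: bij_betw_def)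
  from sum.reindex_bij_betw[OF this, of "\<lambda>j. P (int t - 1 - 2 * j)"]
  have "(\<Sum>r\<in>{0..<int t}. P (int t - 1 - 2 * j r)) = (\<Sum>j\<in>{0..<int t}. P (int t - 1 - 2 * j))" .
  moreover have "int t - 1 - 2 * j r = arc_bias s t r" for r using j[of r] by linarith
  ultimately show "(\<Sum>r\<in>{0..<int t}. P (arc_bias s t r)) = (\<Sum>j<t. P (int t - 1 - 2 * int j))"
    by (simp add: sum_int_interval)
qed

text \<open>The arc length \<open>k\<close> satisfies \<open>2 * r + 1 = s * k\<close> modulo
  \<open>t\<close>, and for odd \<open>t\<close> this can be solved uniquely for
  \<open>r\<close>.\<close>

lemma sum_arc_length:
  assumes "odd t"
  shows "(\<Sum>r\<in>{0..<int t}. P (arc_length s t r)) = (\<Sum>k<t. P k)"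
proof -
  have inj: "inj_on (arc_length s t) {0..<int t}"
  proof (rule inj_onI)
    fix r r' assume r: "r \<in> {0..<int t}" "r' \<in> {0..<int t}" "arc_length s t r = arc_length s t r'"
    have "int t dvd (r - int s * int (arc_length s t r)) - (- 1 - r)"
      "int t dvd (r' - int s * int (arc_length s t r)) - (- 1 - r')"
      using arc_length(2)[of r] arc_length(2)[of r'] r(3) by (metis mod_eq_dvd_iff)+
    from dvd_diff[OF this] have "int t dvd 2 * (r - r')" by (simp add: algebra_simps)
    moreover have "coprime (int t) 2" using assms by simp
    ultimately have "int t dvd r - r'" using coprime_dvd_mult_right_iff[of "int t" 2 "r - r'"] by blast
    then have "r mod int t = r' mod int t" by (simp add: mod_eq_dvd_iff)
    then show "r = r'" using r by simp
  qed
  have "arc_length s t ` {0..<int t} = {..<t}"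
    using arc_length(1) inj by (intro card_subset_eq) (auto simp: card_image)
  then have "bij_betw (arc_length s t) {0..<int t} {..<t}" using inj by (simp add: bij_betw_def)
  then show ?thesis by (rule sum.reindex_bij_betw)
qed

text \<open>For odd \<open>s\<close> everything is expressed through the biases. For even
  \<open>s\<close> the modulus \<open>t\<close> is odd, there is no middle position and the bias
  vanishes, so the arc lengths are summed directly.\<close>

lemma sum_second_moments:
  "3 * (\<Sum>r\<in>{0..<int t}. (arc_bias s t r)\<^sup>2 + 4 * int (s div 2) * (int (arc_length s t r) * (int t - int (arc_length s t r)))) =
    int t * ((int t)\<^sup>2 - 1) + (int s - 1) * int t * (if odd t then (int t)\<^sup>2 - 1 else (int t)\<^sup>2 + 2)"
proof (cases "odd s")
  case True
  have n: "2 * int (s div 2) = int s - 1" using True by presburger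
  have "(\<Sum>r\<in>{0..<int t}. (arc_bias s t r)\<^sup>2 + 4 * int (s div 2) * (int (arc_length s t r) * (int t - int (arc_length s t r)))) =
      (\<Sum>r\<in>{0..<int t}. (arc_bias s t r)\<^sup>2 + 2 * (int s - 1) * (\<bar>arc_bias s t r\<bar> * (int t - \<bar>arc_bias s t r\<bar>)))"
    unfolding sum_arc_bias(2)[OF True] n[symmetric] by simp
  also have "\<dots> = (\<Sum>j<t. (int t - 1 - 2 * int j)\<^sup>2 + 2 * (int s - 1) * (\<bar>int t - 1 - 2 * int j\<bar> * (int t - \<bar>int t - 1 - 2 * int j\<bar>)))"
    by (rule sum_arc_bias(1)[OF True, of "\<lambda>d. d\<^sup>2 + 2 * (int s - 1) * (\<bar>d\<bar> * (int t - \<bar>d\<bar>))"])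
  also have "\<dots> = (\<Sum>j<t. (int t - 1 - 2 * int j)\<^sup>2) + 2 * (int s - 1) * (int t * (\<Sum>j<t. \<bar>int t - 1 - 2 * int j\<bar>) - (\<Sum>j<t. (int t - 1 - 2 * int j)\<^sup>2))"
  proof -
    have "\<bar>d\<bar> * (int t - \<bar>d\<bar>) = int t * \<bar>d\<bar> - d\<^sup>2" for d
      by (simp add: power2_eq_square right_diff_distrib mult.commute)
    then show ?thesis by (simp add: sum.distrib sum_subtractf sum_distrib_left[symmetric])
  qed
  finally have *: "(\<Sum>r\<in>{0..<int t}. (arc_bias s t r)\<^sup>2 + 4 * int (s div 2) * (int (arc_length s t r) * (int t - int (arc_length s t r)))) = \<dots>" .
  \<comment> \<open>After inserting the two sums, the factor of \<open>(s - 1) * t\<close> is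
    \<open>3 * t\<^sup>2 - 2 * (t\<^sup>2 - 1) = t\<^sup>2 + 2\<close> for even \<open>t\<close>,
    and smaller by 3 for odd \<open>t\<close>.\<close>
  have **: "3 * (\<Sum>r\<in>{0..<int t}. (arc_bias s t r)\<^sup>2 + 4 * int (s div 2) * (int (arc_length s t r) * (int t - int (arc_length s t r)))) =
      3 * (\<Sum>j<t. (int t - 1 - 2 * int j)\<^sup>2) + (int s - 1) * (3 * int t * (2 * (\<Sum>j<t. \<bar>int t - 1 - 2 * int j\<bar>)) - 2 * (3 * (\<Sum>j<t. (int t - 1 - 2 * int j)\<^sup>2)))"
    unfolding * by (simp add: algebra_simps)
  show ?thesis
    unfolding ** sum_square_odd_steps sum_abs_odd_steps by (simp add: algebra_simps power2_eq_square)
next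
  case False
  then have "odd t" using co coprime_common_divisor[of s t 2] by auto
  have n: "2 * int (s div 2) = int s" using False by presburger
  have bias: "arc_bias s t r = 0" for r
    unfolding arc_bias_def n using False by simp
  have "3 * (\<Sum>r\<in>{0..<int t}. (arc_bias s t r)\<^sup>2 + 4 * int (s div 2) * (int (arc_length s t r) * (int t - int (arc_length s t r)))) =
      2 * int (s div 2) * (6 * (\<Sum>r\<in>{0..<int t}. int (arc_length s t r) * (int t - int (arc_length s t r))))"
    by (simp add: bias sum_distrib_left[symmetric])
  also have "\<dots> = int s * (int t * ((int t)\<^sup>2 - 1))"
    unfolding sum_arc_length[OF \<open>odd t\<close>, of "\<lambda>k. int k * (int t - int k)"] sum_mult_complement n ..
  finally show ?thesis using \<open>odd t\<close> by (simp add: algebra_simps)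
qed

end

text \<open>The formula of \<open>psize_eq_sum_gap\<close> solved for the size, as a function of the
  set, so that it can be summed over patterns.\<close>

definition core_size :: "nat \<Rightarrow> int set \<Rightarrow> real" where
  "core_size t B = (3 * (\<Sum>r\<in>{0..<int t}. (real_of_int (2 * gap t B r - (int t - 1)))\<^sup>2)
    - real t * ((real t)\<^sup>2 - 1)) / (24 * real t)"

lemma psize_eq_core_size:
  assumes "t \<ge> 1" "l \<in> self_conj_cores t"
  shows "real (psize l) = core_size t (beta_set l)"
proof -
  have "beta_set l \<in> sym_cores t" "is_partition l"
    using self_conj_cores_imp_sym_beta[OF assms] by (simp_all add: sym_cores_def)
  from arg_cong[OF psize_eq_sum_gap[OF assms(1) this(2,1)], of real_of_int]
  have "24 * real t * real (psize l) = 3 * (\<Sum>r\<in>{0..<int t}. (real_of_int (2 * gap t (beta_set l) r - (int t - 1)))\<^sup>2)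
    - real t * ((real t)\<^sup>2 - 1)" by simp
  then show ?thesis using assms(1) by (simp add: core_size_def field_simps)
qed

lemma bij_betw_beta_set_Int:
  assumes "s \<ge> 1" "t \<ge> 1"
  shows "bij_betw beta_set (self_conj_cores s \<inter> self_conj_cores t) (sym_cores s \<inter> sym_cores t)"
proof (rule bij_betw_subset[OF bij_betw_beta_set[OF assms(1)]])
  have t_iff: "l \<in> self_conj_cores t \<longleftrightarrow> beta_set l \<in> sym_cores t" if "l \<in> self_conj_cores s" for l
    using that self_conj_cores_imp_sym_beta[OF assms(1) that] cores_iff[OF assms(2)]
    by (simp add: self_conj_cores_def sym_cores_def)
  have img: "beta_set ` self_conj_cores s = sym_cores s"
    using bij_betw_beta_set[OF assms(1)] by (simp add: bij_betw_def)
  show "beta_set ` (self_conj_cores s \<inter> self_conj_cores t) = sym_cores s \<inter> sym_cores t"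
    unfolding img[symmetric] using t_iff by blast
qed simp

theorem theorem1p4:
  fixes s t :: nat
  assumes "s \<ge> 1" and "t \<ge> 1" and "coprime s t"
  shows
    "(\<Sum>l \<in> self_conj_cores s \<inter> self_conj_cores t.
        inverse (real (card (stabilizer (H_group s t) (core_action s) l))) * real (psize l))
     / (\<Sum>l \<in> self_conj_cores s \<inter> self_conj_cores t.
        inverse (real (card (stabilizer (H_group s t) (core_action s) l))))
     = (if odd t then 1 / 24 * (real s - 1) * (real t ^ 2 - 1)
        else 1 / 24 * (real s - 1) * (real t ^ 2 + 2))"
proof -
  let ?D = "self_conj_cores s \<inter> self_conj_cores t" and ?B = "sym_cores s \<inter> sym_cores t"
  define K where "K = real (card {g \<in> aff_hyp s. g ` {..<0} = {..<0}})"
  define N where "N = real t ^ (s div 2)"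
  define W where "W G = (\<Sum>l\<in>?D. inverse (real (card (stabilizer (H_group s t) (core_action s) l))) * G (beta_set l))"
    for G :: "int set \<Rightarrow> real"
  have W: "K * W G = (\<Sum>x\<in>patterns s t. G (core_rep s t x ` {..<0}))" for G
  proof -
    have "W G = (\<Sum>l\<in>?D. inverse (real (card (stab s t (beta_set l)))) * G (beta_set l))"
      unfolding W_def using stabilizer_eq_stab[OF assms(1)] by (intro sum.cong) auto
    also have "\<dots> = (\<Sum>B\<in>?B. inverse (real (card (stab s t B))) * G B)"
      by (rule sum.reindex_bij_betw[OF bij_betw_beta_set_Int[OF assms(1,2)]])
    finally show ?thesis using sum_cores_eq_sum_patterns[OF assms] by (simp add: K_def)
  qed
  have N: "N > 0" using assms(2) by (simp add: N_def)
  have "card (patterns s t) = t ^ (s div 2)" by (simp add: patterns_def card_PiE)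
  \<comment> \<open>The constant weight 1 merely counts patterns. The order \<open>K\<close> of the
    finite subgroup cancels in the quotient.\<close>
  then have den: "K * W (\<lambda>_. 1) = N" unfolding W by (simp add: N_def)
  then have K: "K \<noteq> 0" using N by auto
  have "(\<Sum>x\<in>patterns s t. \<Sum>r\<in>{0..<int t}. (real_of_int (2 * gap t (core_rep s t x ` {..<0}) r - (int t - 1)))\<^sup>2) =
      N * real_of_int (\<Sum>r\<in>{0..<int t}. (arc_bias s t r)\<^sup>2
        + 4 * int (s div 2) * (int (arc_length s t r) * (int t - int (arc_length s t r))))"
    by (subst sum.swap) (simp only: sum_square_gap_core_rep[OF assms] N_def sum_distrib_left of_int_sum)
  then have "3 * (\<Sum>x\<in>patterns s t. \<Sum>r\<in>{0..<int t}. (real_of_int (2 * gap t (core_rep s t x ` {..<0}) r - (int t - 1)))\<^sup>2) =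
      N * real_of_int (3 * (\<Sum>r\<in>{0..<int t}. (arc_bias s t r)\<^sup>2
        + 4 * int (s div 2) * (int (arc_length s t r) * (int t - int (arc_length s t r)))))"
    by (simp only: of_int_mult of_int_numeral mult.left_commute)
  also have "\<dots> = N * (real t * ((real t)\<^sup>2 - 1) + (real s - 1) * real t * (if odd t then (real t)\<^sup>2 - 1 else (real t)\<^sup>2 + 2))"
    unfolding sum_second_moments[OF assms] by simp
  \<comment> \<open>The part \<open>t * (t\<^sup>2 - 1)\<close> of the second moments cancels
    against the normalisation of the empty partition, leaving a multiple of
    \<open>s - 1\<close>.\<close>
  finally have "(\<Sum>x\<in>patterns s t. core_size t (core_rep s t x ` {..<0})) =
      (N * (real t * ((real t)\<^sup>2 - 1) + (real s - 1) * real t * (if odd t then (real t)\<^sup>2 - 1 else (real t)\<^sup>2 + 2))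
        - N * (real t * ((real t)\<^sup>2 - 1))) / (24 * real t)"
    using \<open>card (patterns s t) = t ^ (s div 2)\<close>
    by (simp add: core_size_def sum_divide_distrib[symmetric] sum_subtractf sum_distrib_left[symmetric] N_def)
  also have "\<dots> = N * ((real s - 1) * (if odd t then (real t)\<^sup>2 - 1 else (real t)\<^sup>2 + 2) / 24)"
    using assms(2) by (simp add: field_simps)
  finally have num: "K * W (core_size t) = \<dots>" unfolding W .
  have "W (core_size t) / W (\<lambda>_. 1) = (K * W (core_size t)) / (K * W (\<lambda>_. 1))" using K by simp
  also have "\<dots> = (real s - 1) * (if odd t then (real t)\<^sup>2 - 1 else (real t)\<^sup>2 + 2) / 24"
    unfolding num den using N by simp
  finally have "W (core_size t) / W (\<lambda>_. 1) = \<dots>" .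
  moreover have "W (core_size t) = (\<Sum>l\<in>?D. inverse (real (card (stabilizer (H_group s t) (core_action s) l))) * real (psize l))"
    unfolding W_def using psize_eq_core_size[OF assms(2)] by (intro sum.cong) auto
  ultimately show ?thesis by (simp add: W_def)
qed

end
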